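(* Let $\lambda,\mu\in C^1([-1,1])$ be positive with $\lambda(w)>\mu(-w)$ for all $w\in[-1,1]$, and $b,c\in C([-1,1])$, and assume $h_1(0)=0$ where $h_1(w)=\frac{b(w)}{\lambda(w)+\mu(w)}$. Let $E=\{(z,w)\in[-1,1]^2:|z|\le|w|\}$. Then the system $$\lambda(w)L^{11}_w(z,w)+\lambda(z)L^{11}_z(z,w)=-\lambda'(z)L^{11}(z,w)-c(z)L^{12}(z,w),$$ $$\lambda(w)L^{12}_w(z,w)-\mu(z)L^{12}_z(z,w)=-b(z)L^{11}(z,w)+\mu'(z)L^{12}(z,w),$$ $$L^{11}(-w,w)=0,\qquad L^{12}(w,w)=h_1(w),\qquad L^{12}(-w,w)=0,$$ together with $$\mu(w)L^{22}_w(z,w)+\mu(z)L^{22}_z(z,w)=b(z)L^{21}(z,w)-\mu'(z)L^{22}(z,w),$$ $$\mu(w)L^{21}_w(z,w)-\lambda(z)L^{21}_z(z,w)=\lambda'(z)L^{21}(z,w)+c(z)L^{22}(z,w),$$ $$L^{22}(-w,w)=0,\qquad L^{21}(w,w)=h_2(w):=-\frac{c(w)}{\lambda(w)+\mu(w)},$$ posed on $E$ (in the sense of the integral equations along characteristics), has a unique solution with $L^{11},L^{21},L^{22}\in C(E)$ and $L^{12}\in L^\infty(E)$.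
   Context: On $E_1=\{0\le w\le1,\ -w\le z\le w\}$ the characteristics of $L^{12}$ issue from the diagonal $z=w$ when $\phi_1(w)+\phi_2(z)\ge0$ and from the antidiagonal $z=-w$ when $\phi_1(w)+\phi_2(z)<0$, where $\phi_1(w)=\int_0^w dy/\lambda(y)$, $\phi_2(w)=\int_0^w dy/\mu(y)$; $L^{12}$ may be discontinuous across the curve $\phi_1(w)+\phi_2(z)=0$. *)

theory Defs
  imports "HOL-Analysis.Analysis"
begin

definition kerE :: "(real \<times> real) set" where
  "kerE = {(z,w). -1 \<le> w \<and> w \<le> 1 \<and> \<bar>z\<bar> \<le> \<bar>w\<bar>}"

definition char_curve ::
  "(real \<Rightarrow> real) \<Rightarrow> (real \<Rightarrow> real) \<Rightarrow> real \<Rightarrow> real \<Rightarrow> (real \<Rightarrow> real \<times> real) \<Rightarrow> bool" where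
  "char_curve a d s0 s1 \<gamma> \<longleftrightarrow> s0 \<le> s1 \<and>
     (\<forall>s\<in>{s0..s1}. \<gamma> s \<in> kerE \<and>
        (\<gamma> has_vector_derivative (d (fst (\<gamma> s)), a (snd (\<gamma> s)))) (at s within {s0..s1}))"

text \<open>The equation  a(w) L_w + d(z) L_z = F(z,w)  holds in the sense of integral
  equations along characteristics: along every characteristic segment in E,
  L(end) - L(start) equals the integral of F.\<close>
definition char_sol ::
  "(real \<Rightarrow> real) \<Rightarrow> (real \<Rightarrow> real) \<Rightarrow> (real \<Rightarrow> real \<Rightarrow> real) \<Rightarrow> (real \<Rightarrow> real \<Rightarrow> real) \<Rightarrow> bool" where
  "char_sol a d L F \<longleftrightarrow> (\<forall>s0 s1 \<gamma>. char_curve a d s0 s1 \<gamma> \<longrightarrow>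
     ((\<lambda>s. F (fst (\<gamma> s)) (snd (\<gamma> s))) has_integral
        (L (fst (\<gamma> s1)) (snd (\<gamma> s1)) - L (fst (\<gamma> s0)) (snd (\<gamma> s0)))) {s0..s1})"

definition kernel_solution ::
  "(real \<Rightarrow> real) \<Rightarrow> (real \<Rightarrow> real) \<Rightarrow> (real \<Rightarrow> real) \<Rightarrow> (real \<Rightarrow> real) \<Rightarrow>
   (real \<Rightarrow> real) \<Rightarrow> (real \<Rightarrow> real) \<Rightarrow>
   (real \<Rightarrow> real \<Rightarrow> real) \<Rightarrow> (real \<Rightarrow> real \<Rightarrow> real) \<Rightarrow>
   (real \<Rightarrow> real \<Rightarrow> real) \<Rightarrow> (real \<Rightarrow> real \<Rightarrow> real) \<Rightarrow> bool" where
  "kernel_solution lam lam' mu mu' b c L11 L12 L21 L22 \<longleftrightarrow>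
     continuous_on kerE (\<lambda>(z,w). L11 z w) \<and>
     continuous_on kerE (\<lambda>(z,w). L21 z w) \<and>
     continuous_on kerE (\<lambda>(z,w). L22 z w) \<and>
     bounded ((\<lambda>(z,w). L12 z w) ` kerE) \<and>
     set_borel_measurable lebesgue kerE (\<lambda>(z,w). L12 z w) \<and>
     char_sol lam lam L11 (\<lambda>z w. - lam' z * L11 z w - c z * L12 z w) \<and>
     char_sol lam (\<lambda>z. - mu z) L12 (\<lambda>z w. - b z * L11 z w + mu' z * L12 z w) \<and>
     char_sol mu mu L22 (\<lambda>z w. b z * L21 z w - mu' z * L22 z w) \<and>
     char_sol mu (\<lambda>z. - lam z) L21 (\<lambda>z w. lam' z * L21 z w + c z * L22 z w) \<and>
     (\<forall>w\<in>{-1..1}.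
        L11 (-w) w = 0 \<and>
        L12 w w = b w / (lam w + mu w) \<and>
        L12 (-w) w = 0 \<and>
        L22 (-w) w = 0 \<and>
        L21 w w = - c w / (lam w + mu w))"

end

theory Submission
  imports Defs
begin

text \<open>
  Since \<open>h\<^sub>1(0) = 0\<close>, the boundary data of \<open>L\<^sup>1\<^sup>2\<close> transported along characteristics are continuous even
  across the characteristic through the origin, so a solution can be sought among continuous kernels.
  With \<open>fa\<close> and \<open>fd\<close> antiderivatives of \<open>1/a\<close> and \<open>1/d\<close>, a characteristic of \<open>a(w) L\<^sub>w + d(z) L\<^sub>z = F\<close> is a
  level set of \<open>fd z - fa w\<close> on which \<open>fa w\<close> grows at unit speed. Both families of characteristics of a coupled
  pair of equations thus share the time \<open>fa w\<close>, which moves away from 0 between the point where data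
  are prescribed and the point of evaluation. Therefore integration along characteristics is a contraction for
  the norm weighted by \<open>exp (K \<bar>fa w\<bar>)\<close> with \<open>K\<close> large, which gives existence, and the same estimate gives
  uniqueness among bounded solutions.
\<close>

section \<open>Extending the coefficients from [-1,1] to the real line\<close>

definition clamp1 :: "real \<Rightarrow> real" where
  "clamp1 x = max (-1) (min 1 x)"

lemma clamp1_bounds [simp]: "- 1 \<le> clamp1 x" "clamp1 x \<le> 1"
  by (auto simp: clamp1_def)

lemma clamp1_id: "x \<in> {-1..1} \<Longrightarrow> clamp1 x = x"
  by (auto simp: clamp1_def)

lemma clamp1_uminus: "clamp1 (- x) = - clamp1 x"
  by (auto simp: clamp1_def)

text \<open>Clamping extends a coefficient by its boundary values. Bounds and positivity on [-1,1]
  then hold on the whole line, so travel times become homeomorphisms of the line.\<close>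

lemma continuous_on_compose_clamp1:
  fixes f :: "real \<Rightarrow> real"
  assumes "continuous_on {-1..1} f"
  shows "continuous_on UNIV (\<lambda>x. f (clamp1 x))"
proof -
  have "continuous_on UNIV clamp1"
    unfolding clamp1_def by (intro continuous_intros)
  then show ?thesis
    by (rule continuous_on_compose2[OF assms]) auto
qed

lemma compose_clamp1_bounded:
  fixes f :: "real \<Rightarrow> real"
  assumes "continuous_on {-1..1} f"
  obtains M where "M > 0" "\<And>x. \<bar>f (clamp1 x)\<bar> \<le> M"
proof -
  have "bounded (f ` {-1..1})"
    using assms by (intro compact_imp_bounded compact_continuous_image) auto
  then obtain M where "M > 0" "\<forall>y\<in>f ` {-1..1}. norm y \<le> M"
    by (auto simp: bounded_pos)
  then show ?thesis
    by (intro that[of M]) auto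
qed

lemma compose_clamp1_bounded_below:
  fixes f :: "real \<Rightarrow> real"
  assumes "continuous_on {-1..1} f" "\<And>x. x \<in> {-1..1} \<Longrightarrow> f x > 0"
  obtains m where "m > 0" "\<And>x. m \<le> f (clamp1 x)"
proof -
  obtain x0 where "x0 \<in> {-1..1}" "\<And>x. x \<in> {-1..1} \<Longrightarrow> f x0 \<le> f x"
    using continuous_attains_inf[of "{-1..1}" f] assms(1) by fastforce
  then show ?thesis
    using assms(2) by (intro that[of "f x0"]) auto
qed

section \<open>Increasing homeomorphisms of the line and antiderivatives\<close>

definition incr_homeo :: "(real \<Rightarrow> real) \<Rightarrow> (real \<Rightarrow> real) \<Rightarrow> bool" where
  "incr_homeo f g \<longleftrightarrow> strict_mono f \<and> continuous_on UNIV f \<and> continuous_on UNIV g \<and> (\<forall>y. f (g y) = y)"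

text \<open>The equivalences that move \<open>g\<close> across an inequality are the main tool
  below: they turn claims about entry points and membership in \<open>kerE\<close> into comparisons
  of travel times.\<close>

lemma incr_homeoD:
  assumes "incr_homeo f g"
  shows "f (g y) = y" "g (f x) = x" "f x \<le> f x' \<longleftrightarrow> x \<le> x'" "f x < f x' \<longleftrightarrow> x < x'" "f x = f x' \<longleftrightarrow> x = x'"
    "g y \<le> x \<longleftrightarrow> y \<le> f x" "x \<le> g y \<longleftrightarrow> f x \<le> y" "continuous_on S f" "continuous_on S g"
proof -
  have m: "strict_mono f" and fg: "\<And>y. f (g y) = y"
    using assms by (auto simp: incr_homeo_def)
  show "f (g y) = y" by fact
  show le: "f x \<le> f x' \<longleftrightarrow> x \<le> x'" for x x'
    using m by (rule strict_mono_less_eq)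
  show "f x < f x' \<longleftrightarrow> x < x'"
    using m by (rule strict_mono_less)
  show eq: "f x = f x' \<longleftrightarrow> x = x'" for x x'
    using m by (rule strict_mono_eq)
  show "g (f x) = x"
    using eq fg by metis
  show "g y \<le> x \<longleftrightarrow> y \<le> f x"
    using le fg by metis
  show "x \<le> g y \<longleftrightarrow> f x \<le> y"
    using le fg by metis
  show "continuous_on S f" "continuous_on S g"
    using assms by (auto simp: incr_homeo_def intro: continuous_on_subset)
qed

text \<open>By the mean value theorem \<open>f\<close> grows at least at rate
  \<open>\<delta>\<close>. Hence it is strictly increasing, takes every value by the intermediate
  value theorem, and has an inverse with Lipschitz constant \<open>1 / \<delta>\<close>.\<close>

lemma incr_homeo_if_deriv_bounded_below:
  fixes f f' :: "real \<Rightarrow> real"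
  assumes der: "\<And>x. (f has_real_derivative f' x) (at x)"
    and pos: "\<delta> > 0" "\<And>x. \<delta> \<le> f' x"
  obtains g where "incr_homeo f g"
proof -
  have grow: "\<delta> * (y - x) \<le> f y - f x" if "x \<le> y" for x y
  proof (cases "x = y")
    case False
    then have "x < y" using that by auto
    then obtain z where "f y - f x = (y - x) * f' z"
      using MVT2[of x y f f'] der by blast
    then show ?thesis
      using pos(2)[of z] \<open>x < y\<close> by (simp add: mult.commute)
  qed auto
  have sm: "strict_mono f"
  proof (rule strict_monoI)
    fix x y :: real assume "x < y"
    then show "f x < f y"
      using grow[of x y] pos(1) mult_pos_pos[of \<delta> "y - x"] by linarith
  qed
  have cf: "continuous_on UNIV f"
    using der by (meson DERIV_continuous continuous_at_imp_continuous_on)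
  have "\<exists>x. f x = y" for y
  proof -
    define r where "r = (\<bar>y\<bar> + \<bar>f 0\<bar>) / \<delta>"
    have r: "r \<ge> 0" "\<delta> * r = \<bar>y\<bar> + \<bar>f 0\<bar>"
      using pos(1) by (auto simp: r_def)
    have "f (-r) \<le> y" "y \<le> f r"
      using grow[of "-r" 0] grow[of 0 r] r by auto
    then have "\<exists>x\<ge>-r. x \<le> r \<and> f x = y"
      using r(1) continuous_on_subset[OF cf] by (intro IVT') auto
    then show ?thesis by blast
  qed
  then obtain g where g: "\<And>y. f (g y) = y" by metis
  have lip: "\<bar>g x - g y\<bar> \<le> (1 / \<delta>) * \<bar>x - y\<bar>" for x y
  proof -
    have "\<delta> * \<bar>g x - g y\<bar> \<le> \<bar>x - y\<bar>"
      using grow[of "g x" "g y"] grow[of "g y" "g x"] g[of x] g[of y] by (cases "g x \<le> g y") auto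
    then show ?thesis
      using pos(1) by (simp add: field_simps)
  qed
  have "(1 / \<delta>)-lipschitz_on UNIV g"
    using lip pos(1) by (intro lipschitz_onI) (auto simp: dist_real_def)
  then have "continuous_on UNIV g"
    by (rule lipschitz_on_continuous_on)
  then show ?thesis
    using that[of g] sm cf g by (auto simp: incr_homeo_def)
qed

lemma antiderivative_UNIV:
  fixes f :: "real \<Rightarrow> real"
  assumes "continuous_on UNIV f"
  obtains F where "F 0 = 0" "\<And>x. (F has_real_derivative f x) (at x)"
proof -
  have "\<exists>F. \<forall>x. -\<infinity> < ereal x \<longrightarrow> ereal x < \<infinity> \<longrightarrow> (F has_vector_derivative f x) (at x)"
    using assms by (intro einterval_antiderivative) (auto simp: continuous_on_eq_continuous_at)
  then obtain F where F: "\<And>x. (F has_real_derivative f x) (at x)"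
    by (auto simp: has_real_derivative_iff_has_vector_derivative)
  show ?thesis
    using F by (intro that[of "\<lambda>x. F x - F 0"]) (auto intro!: derivative_eq_intros)
qed

subsection \<open>Transport along characteristics\<close>

lemma kerE_iff: "(z, w) \<in> kerE \<longleftrightarrow> w \<in> {-1..1} \<and> (if w \<le> 0 then w \<le> z \<and> z \<le> -w else -w \<le> z \<and> z \<le> w)"
  by (auto simp: kerE_def)

lemma compact_kerE: "compact kerE"
proof -
  have "kerE = ({-1..1} \<times> {-1..1}) \<inter> {p. \<bar>fst p\<bar> \<le> \<bar>snd p\<bar>}"
    by (auto simp: kerE_def)
  moreover have "closed {p :: real \<times> real. \<bar>fst p\<bar> \<le> \<bar>snd p\<bar>}"
    by (intro closed_Collect_le continuous_intros)
  ultimately show ?thesis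
    by (metis compact_Int_closed compact_Times compact_Icc)
qed

text \<open>Retracting onto \<open>kerE\<close> lets the fixed point be sought among bounded continuous functions on the plane.\<close>
definition retr :: "real \<times> real \<Rightarrow> real \<times> real" where
  "retr p = (max (- \<bar>clamp1 (snd p)\<bar>) (min \<bar>clamp1 (snd p)\<bar> (fst p)), clamp1 (snd p))"

lemma retr: "retr p \<in> kerE" "p \<in> kerE \<Longrightarrow> retr p = p" "continuous_on UNIV retr"
proof -
  show "retr p \<in> kerE"
    using clamp1_bounds[of "snd p"] by (auto simp: retr_def kerE_def)
  show "p \<in> kerE \<Longrightarrow> retr p = p"
    by (auto simp: retr_def kerE_def clamp1_id)
  show "continuous_on UNIV retr"
    unfolding retr_def[abs_def] clamp1_def by (intro continuous_intros)
qed

text \<open>Characteristics and the equation along them see values on \<open>kerE\<close> only,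
  which justifies passing to clamped coefficients and to kernels changed outside
  \<open>kerE\<close>.\<close>

lemma char_sol_cong:
  assumes "\<And>z w. (z, w) \<in> kerE \<Longrightarrow> a w = a' w \<and> d z = d' z \<and> L z w = L' z w \<and> F z w = F' z w"
  shows "char_sol a d L F = char_sol a' d' L' F'"
proof -
  have 1: "char_curve a d s0 s1 \<gamma> = char_curve a' d' s0 s1 \<gamma>" for s0 s1 \<gamma>
    unfolding char_curve_def using assms by (metis prod.collapse)
  have 2: "((\<lambda>s. F (fst (\<gamma> s)) (snd (\<gamma> s))) has_integral
        L (fst (\<gamma> s1)) (snd (\<gamma> s1)) - L (fst (\<gamma> s0)) (snd (\<gamma> s0))) {s0..s1}
     \<longleftrightarrow> ((\<lambda>s. F' (fst (\<gamma> s)) (snd (\<gamma> s))) has_integral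
        L' (fst (\<gamma> s1)) (snd (\<gamma> s1)) - L' (fst (\<gamma> s0)) (snd (\<gamma> s0))) {s0..s1}"
    if "char_curve a d s0 s1 \<gamma>" for s0 s1 \<gamma>
  proof -
    have eq: "F (fst (\<gamma> s)) (snd (\<gamma> s)) = F' (fst (\<gamma> s)) (snd (\<gamma> s))"
      "L (fst (\<gamma> s)) (snd (\<gamma> s)) = L' (fst (\<gamma> s)) (snd (\<gamma> s))" if "s \<in> {s0..s1}" for s
      using that \<open>char_curve a d s0 s1 \<gamma>\<close> assms[of "fst (\<gamma> s)" "snd (\<gamma> s)"]
      by (auto simp: char_curve_def)
    have "s0 \<le> s1"
      using that by (simp add: char_curve_def)
    then show ?thesis
      using eq(2)[of s0] eq(2)[of s1] has_integral_cong[of "{s0..s1}", OF eq(1)] by simp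
  qed
  show ?thesis
    unfolding char_sol_def 1[symmetric] using 2 by auto
qed

lemma char_sol_diff:
  assumes "char_sol a d L F" "char_sol a d L' F'"
  shows "char_sol a d (\<lambda>z w. L z w - L' z w) (\<lambda>z w. F z w - F' z w)"
  unfolding char_sol_def
proof (intro allI impI)
  fix s0 s1 \<gamma> assume c: "char_curve a d s0 s1 \<gamma>"
  show "((\<lambda>s. F (fst (\<gamma> s)) (snd (\<gamma> s)) - F' (fst (\<gamma> s)) (snd (\<gamma> s))) has_integral
       L (fst (\<gamma> s1)) (snd (\<gamma> s1)) - L' (fst (\<gamma> s1)) (snd (\<gamma> s1)) -
       (L (fst (\<gamma> s0)) (snd (\<gamma> s0)) - L' (fst (\<gamma> s0)) (snd (\<gamma> s0)))) {s0..s1}"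
    using has_integral_diff[OF assms(1)[unfolded char_sol_def, rule_format, OF c]
      assms(2)[unfolded char_sol_def, rule_format, OF c]]
    by (simp add: algebra_simps)
qed

text \<open>\<open>en (z, w)\<close> is the \<open>w\<close>-coordinate of the point where the characteristic through \<open>(z, w)\<close> enters \<open>kerE\<close>,
  coming from the side of \<open>w = 0\<close> (for \<open>w < 0\<close> this is backwards along the characteristic).\<close>
locale transport =
  fixes a d fa ga fd gd :: "real \<Rightarrow> real" and en :: "real \<times> real \<Rightarrow> real"
  assumes fa: "incr_homeo fa ga" "fa 0 = 0" "\<And>x. (fa has_real_derivative 1 / a x) (at x)" "\<And>x. a x > 0"
    and fd: "\<And>x. (fd has_real_derivative 1 / d x) (at x)" "\<And>x. d x \<noteq> 0"
    and gd: "\<And>x. gd (fd x) = x" "\<And>y. fd (gd y) = y" "continuous_on UNIV gd"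
    and en_cont: "continuous_on kerE en"
    and en_between: "\<And>z w. (z, w) \<in> kerE \<Longrightarrow> en (z, w) \<in> closed_segment 0 w"
    and en_inside: "\<And>z w x. (z, w) \<in> kerE \<Longrightarrow> x \<in> closed_segment (en (z, w)) w
       \<Longrightarrow> (gd (fd z - fa w + fa x), x) \<in> kerE"
    and en_inv: "\<And>z w z' w'. (z, w) \<in> kerE \<Longrightarrow> (z', w') \<in> kerE \<Longrightarrow> fd z - fa w = fd z' - fa w' \<Longrightarrow>
       0 \<le> w * w' \<Longrightarrow> en (z, w) = en (z', w')"
begin

text \<open>This describes data transported unchanged along characteristics. The sign condition is
  there because, for \<open>L12\<close>, one level set can meet \<open>w > 0\<close> and
  \<open>w < 0\<close> in separate pieces that enter at different boundary points.\<close>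

definition char_invariant :: "(real \<times> real \<Rightarrow> real) \<Rightarrow> bool" where
  "char_invariant \<beta> \<longleftrightarrow> (\<forall>z w z' w'. (z, w) \<in> kerE \<longrightarrow> (z', w') \<in> kerE \<longrightarrow> fd z - fa w = fd z' - fa w' \<longrightarrow>
     0 \<le> w * w' \<longrightarrow> \<beta> (z, w) = \<beta> (z', w'))"

text \<open>This is the point of the level set \<open>fd z - fa w = \<kappa>\<close> at time
  \<open>fa w = t\<close>.\<close>

definition pt :: "real \<Rightarrow> real \<Rightarrow> real \<times> real" where
  "pt \<kappa> t = (gd (\<kappa> + t), ga t)"

lemma ga_deriv: "(ga has_real_derivative a (ga t)) (at t)"
proof -
  have "isCont ga t"
    using incr_homeoD(9)[OF fa(1), of UNIV] by (simp add: continuous_on_eq_continuous_at)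
  then have "(ga has_real_derivative inverse (1 / a (ga t))) (at t)"
    using fa(4)[of "ga t"] incr_homeoD(1)[OF fa(1)]
    by (intro DERIV_inverse_function[where f = fa and a = "t - 1" and b = "t + 1"] fa(3)) auto
  then show ?thesis by simp
qed

lemma gd_deriv: "(gd has_real_derivative d (gd t)) (at t)"
proof -
  have "isCont gd t"
    using gd(3) by (simp add: continuous_on_eq_continuous_at)
  then have "(gd has_real_derivative inverse (1 / d (gd t))) (at t)"
    using fd(2)[of "gd t"] gd(2)
    by (intro DERIV_inverse_function[where f = fd and a = "t - 1" and b = "t + 1"] fd(1)) auto
  then show ?thesis by simp
qed

lemma pt_deriv: "(pt \<kappa> has_vector_derivative (d (fst (pt \<kappa> t)), a (snd (pt \<kappa> t)))) (at t within S)"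
proof -
  have "((\<lambda>t. gd (\<kappa> + t)) has_real_derivative d (gd (\<kappa> + t))) (at t)"
    using DERIV_chain2[OF gd_deriv DERIV_add[OF DERIV_const DERIV_ident]] by simp
  then have "((\<lambda>t. (gd (\<kappa> + t), ga t)) has_vector_derivative (d (gd (\<kappa> + t)), a (ga t))) (at t)"
    using ga_deriv[of t]
    by (intro has_vector_derivative_Pair) (auto simp: has_real_derivative_iff_has_vector_derivative)
  then show ?thesis
    by (simp add: pt_def[abs_def] has_vector_derivative_at_within)
qed

text \<open>Separation of variables: along the curve \<open>fa\<close> of the second and
  \<open>fd\<close> of the first coordinate both have derivative 1. Inverting them shows that every
  characteristic is an arc of some \<open>pt \<kappa>\<close>.\<close>

lemma char_curve_times:
  assumes "char_curve a d s0 s1 \<gamma>" "s \<in> {s0..s1}"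
  shows "fa (snd (\<gamma> s)) - s = fa (snd (\<gamma> s0)) - s0" "fd (fst (\<gamma> s)) - s = fd (fst (\<gamma> s0)) - s0"
proof -
  have v: "(\<gamma> has_vector_derivative (d (fst (\<gamma> t)), a (snd (\<gamma> t)))) (at t within {s0..s1})"
    if "t \<in> {s0..s1}" for t
    using assms that by (auto simp: char_curve_def)
  have f: "((\<lambda>t. fst (\<gamma> t)) has_real_derivative d (fst (\<gamma> t))) (at t within {s0..s1})"
    and g: "((\<lambda>t. snd (\<gamma> t)) has_real_derivative a (snd (\<gamma> t))) (at t within {s0..s1})"
    if "t \<in> {s0..s1}" for t
    using bounded_linear.has_vector_derivative[OF bounded_linear_fst v[OF that]]
      bounded_linear.has_vector_derivative[OF bounded_linear_snd v[OF that]]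
    by (auto simp: has_real_derivative_iff_has_vector_derivative)
  have "((\<lambda>t. fa (snd (\<gamma> t)) - t) has_real_derivative 0) (at t within {s0..s1})"
    if "t \<in> {s0..s1}" for t
    using DERIV_diff[OF DERIV_chain2[OF fa(3) g[OF that]] DERIV_ident] fa(4)[of "snd (\<gamma> t)"]
    by simp
  then obtain c where "\<And>t. t \<in> {s0..s1} \<Longrightarrow> fa (snd (\<gamma> t)) - t = c"
    using has_field_derivative_zero_constant[of "{s0..s1}" "\<lambda>t. fa (snd (\<gamma> t)) - t"] by auto
  then show "fa (snd (\<gamma> s)) - s = fa (snd (\<gamma> s0)) - s0"
    using assms by (auto simp: char_curve_def)
  have "((\<lambda>t. fd (fst (\<gamma> t)) - t) has_real_derivative 0) (at t within {s0..s1})"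
    if "t \<in> {s0..s1}" for t
    using DERIV_diff[OF DERIV_chain2[OF fd(1) f[OF that]] DERIV_ident] fd(2)[of "fst (\<gamma> t)"]
    by simp
  then obtain c where "\<And>t. t \<in> {s0..s1} \<Longrightarrow> fd (fst (\<gamma> t)) - t = c"
    using has_field_derivative_zero_constant[of "{s0..s1}" "\<lambda>t. fd (fst (\<gamma> t)) - t"] by auto
  then show "fd (fst (\<gamma> s)) - s = fd (fst (\<gamma> s0)) - s0"
    using assms by (auto simp: char_curve_def)
qed

lemma char_curve_pt:
  assumes "char_curve a d s0 s1 \<gamma>" "s \<in> {s0..s1}"
  shows "\<gamma> s = pt (fd (fst (\<gamma> s0)) - fa (snd (\<gamma> s0))) (fa (snd (\<gamma> s0)) + (s - s0))"
proof -
  have "fd (fst (\<gamma> s)) = fd (fst (\<gamma> s0)) - fa (snd (\<gamma> s0)) + (fa (snd (\<gamma> s0)) + (s - s0))"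
    "fa (snd (\<gamma> s)) = fa (snd (\<gamma> s0)) + (s - s0)"
    using char_curve_times[OF assms] by auto
  then show ?thesis
    unfolding pt_def using gd(1)[of "fst (\<gamma> s)"] incr_homeoD(2)[OF fa(1), of "snd (\<gamma> s)"]
    by (metis prod.collapse)
qed

lemma char_invariant_char_curve:
  assumes "char_invariant \<beta>" "char_curve a d s0 s1 \<gamma>"
  shows "\<beta> (\<gamma> s1) = \<beta> (\<gamma> s0)"
proof -
  have le: "s0 \<le> s1" and inE: "\<And>s. s \<in> {s0..s1} \<Longrightarrow> \<gamma> s \<in> kerE"
    using assms(2) by (auto simp: char_curve_def)
  have eq: "\<beta> (\<gamma> s) = \<beta> (\<gamma> s')"
    if "s \<in> {s0..s1}" "s' \<in> {s0..s1}" "0 \<le> snd (\<gamma> s) * snd (\<gamma> s')" for s s'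
    using assms(1) inE[OF that(1)] inE[OF that(2)] that(3) char_curve_times[OF assms(2) that(1)]
      char_curve_times[OF assms(2) that(2)]
    unfolding char_invariant_def by (metis (no_types, lifting) add_diff_cancel diff_add_cancel diff_diff_eq2 prod.collapse)
  \<comment> \<open>A characteristic that changes the sign of \<open>w\<close> within \<open>kerE\<close> passes through the origin.\<close>
  show ?thesis
  proof (cases "0 \<le> snd (\<gamma> s1) * snd (\<gamma> s0)")
    case True
    then show ?thesis using le by (intro eq) auto
  next
    case False
    have "fa (snd (\<gamma> s0)) \<le> fa (snd (\<gamma> s1))"
      using char_curve_times(1)[OF assms(2), of s1] le by auto
    then have "snd (\<gamma> s0) \<le> snd (\<gamma> s1)"
      by (simp add: incr_homeoD(3)[OF fa(1)])
    with False have "snd (\<gamma> s0) \<le> 0" "0 \<le> snd (\<gamma> s1)"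
      by (auto simp: not_le mult_less_0_iff)
    moreover have "continuous_on {s0..s1} \<gamma>"
      using assms(2) by (auto simp: char_curve_def continuous_on_eq_continuous_within intro: has_vector_derivative_continuous)
    ultimately have "\<exists>s\<ge>s0. s \<le> s1 \<and> snd (\<gamma> s) = 0"
      using le by (intro IVT' continuous_intros) auto
    then obtain s where "s \<in> {s0..s1}" "snd (\<gamma> s) = 0" by auto
    then have "\<beta> (\<gamma> s1) = \<beta> (\<gamma> s)" "\<beta> (\<gamma> s) = \<beta> (\<gamma> s0)"
      using le by (auto intro!: eq)
    then show ?thesis by simp
  qed
qed

lemma char_invariant_en: "char_invariant en"
  using en_inv unfolding char_invariant_def by blast

text \<open>Rescaling the integral from the entry time to \<open>fa w\<close> to the interval \<open>[0, 1]\<close> covers both signs of \<open>w\<close> and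
  reduces continuity to that of a parametric integral.\<close>
definition sol :: "(real \<times> real \<Rightarrow> real) \<Rightarrow> (real \<times> real \<Rightarrow> real) \<Rightarrow> real \<times> real \<Rightarrow> real" where
  "sol \<beta> F p = \<beta> p + (fa (snd p) - fa (en p)) *
     integral {0..1} (\<lambda>r. F (pt (fd (fst p) - fa (snd p)) (fa (en p) + r * (fa (snd p) - fa (en p)))))"

lemma sol_entry: "en p = snd p \<Longrightarrow> sol \<beta> F p = \<beta> p"
  by (simp add: sol_def)

lemma continuous_on_fd: "continuous_on S fd"
  using fd(1) by (meson DERIV_continuous continuous_at_imp_continuous_on)

lemma continuous_on_sol:
  assumes "continuous_on UNIV F" "continuous_on kerE \<beta>"
  shows "continuous_on kerE (sol \<beta> F)"
proof -
  note [continuous_intros] = continuous_on_compose2[OF incr_homeoD(8)[OF fa(1), of UNIV]]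
    continuous_on_compose2[OF incr_homeoD(9)[OF fa(1), of UNIV]]
    continuous_on_compose2[OF continuous_on_fd[of UNIV]] continuous_on_compose2[OF gd(3)]
    continuous_on_compose2[OF assms(1)] continuous_on_compose2[OF en_cont]
  have "continuous_on kerE (\<lambda>p. integral (cbox 0 1)
     (\<lambda>r. F (pt (fd (fst p) - fa (snd p)) (fa (en p) + r * (fa (snd p) - fa (en p))))))"
    unfolding pt_def
    by (intro integral_continuous_on_param, unfold split_def, intro continuous_intros) auto
  then show ?thesis
    unfolding sol_def[abs_def]
    by (intro continuous_intros assms) (auto)
qed

text \<open>On one characteristic \<open>sol\<close> equals \<open>\<beta>\<close> plus the
  increment of an antiderivative \<open>G\<close> from the entry time to the current time. Both
  \<open>\<beta>\<close> and \<open>en\<close> are constant there, so they cancel in the difference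
  of end values and the fundamental theorem of calculus applies.\<close>

lemma char_sol_sol:
  assumes F: "continuous_on UNIV F" and \<beta>: "char_invariant \<beta>"
  shows "char_sol a d (\<lambda>z w. sol \<beta> F (z, w)) (\<lambda>z w. F (z, w))"
  unfolding char_sol_def
proof (intro allI impI)
  fix s0 s1 \<gamma> assume c: "char_curve a d s0 s1 \<gamma>"
  then have le: "s0 \<le> s1" by (auto simp: char_curve_def)
  define \<kappa> where "\<kappa> = fd (fst (\<gamma> s0)) - fa (snd (\<gamma> s0))"
  define f where "f t = F (pt \<kappa> t)" for t
  have "continuous_on UNIV f"
    unfolding f_def pt_def
    by (intro continuous_on_compose2[OF F] continuous_on_compose2[OF gd(3)] continuous_intros
        incr_homeoD(9)[OF fa(1)]) auto
  then obtain G where G: "\<And>x. (G has_real_derivative f x) (at x)"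
    using antiderivative_UNIV by blast
  \<comment> \<open>The substitution back from [0,1] is valid for either order of \<open>t\<close>
    and \<open>t0\<close>, so both signs of \<open>w\<close> are treated at once.\<close>
  have scaled: "(t - t0) * integral {0..1} (\<lambda>r. f (t0 + r * (t - t0))) = G t - G t0" for t t0
  proof -
    have "((\<lambda>r. G (t0 + r * (t - t0))) has_real_derivative (t - t0) * f (t0 + r * (t - t0))) (at r within {0..1})" for r
    proof -
      have "((\<lambda>r. t0 + r * (t - t0)) has_real_derivative (t - t0)) (at r within {0..1})"
        by (auto intro!: derivative_eq_intros)
      from DERIV_chain2[OF G this] show ?thesis by (simp add: mult.commute)
    qed
    then have "((\<lambda>r. (t - t0) * f (t0 + r * (t - t0))) has_integral G (t0 + 1 * (t - t0)) - G (t0 + 0 * (t - t0))) {0..1}"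
      by (intro fundamental_theorem_of_calculus) (auto simp: has_real_derivative_iff_has_vector_derivative)
    from integral_unique[OF this] show ?thesis by simp
  qed
  define h where "h s = fa (snd (\<gamma> s0)) + (s - s0)" for s
  have fah: "fa (snd (\<gamma> s)) = h s" and \<kappa>: "fd (fst (\<gamma> s)) - fa (snd (\<gamma> s)) = \<kappa>" and \<gamma>: "\<gamma> s = pt \<kappa> (h s)"
    if "s \<in> {s0..s1}" for s
    using char_curve_times[OF c that] char_curve_pt[OF c that] by (auto simp: h_def \<kappa>_def)
  have sol: "sol \<beta> F (\<gamma> s) = \<beta> (\<gamma> s) + (G (h s) - G (fa (en (\<gamma> s))))" if "s \<in> {s0..s1}" for s
    using scaled[of "h s" "fa (en (\<gamma> s))"] \<kappa>[OF that] fah[OF that] by (simp add: sol_def f_def)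
  have "((\<lambda>s. F (\<gamma> s)) has_integral G (h s1) - G (h s0)) {s0..s1}"
  proof (rule fundamental_theorem_of_calculus[OF le])
    fix s assume s: "s \<in> {s0..s1}"
    have "((\<lambda>s. G (h s)) has_real_derivative f (h s)) (at s within {s0..s1})"
    proof -
      have "(h has_real_derivative 1) (at s within {s0..s1})"
        unfolding h_def by (auto intro!: derivative_eq_intros)
      from DERIV_chain2[OF G this] show ?thesis by simp
    qed
    then show "((\<lambda>s. G (h s)) has_vector_derivative F (\<gamma> s)) (at s within {s0..s1})"
      using \<gamma>[OF s] by (simp add: has_real_derivative_iff_has_vector_derivative f_def)
  qed
  moreover have "sol \<beta> F (\<gamma> s1) - sol \<beta> F (\<gamma> s0) = G (h s1) - G (h s0)"
    using le sol[of s0] sol[of s1] char_invariant_char_curve[OF \<beta> c] char_invariant_char_curve[OF char_invariant_en c]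
    by auto
  ultimately show "((\<lambda>s. F (fst (\<gamma> s), snd (\<gamma> s))) has_integral
      sol \<beta> F (fst (\<gamma> s1), snd (\<gamma> s1)) - sol \<beta> F (fst (\<gamma> s0), snd (\<gamma> s0))) {s0..s1}"
    by simp
qed

text \<open>A \<open>closed_segment\<close> ignores the order of its end points, so the arc between
  entry and \<open>(z, w)\<close> is covered for both signs of \<open>w\<close>. The case
  \<open>t0 = t1\<close> yields membership of single points in \<open>kerE\<close>.\<close>

lemma char_curve_from_entry:
  assumes "(z, w) \<in> kerE" "{t0..t1} \<subseteq> closed_segment (fa (en (z, w))) (fa w)" "t0 \<le> t1"
  shows "char_curve a d t0 t1 (pt (fd z - fa w))"
  unfolding char_curve_def
proof (intro conjI ballI pt_deriv)
  fix t assume "t \<in> {t0..t1}"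
  with assms(2) have "t \<in> closed_segment (fa (en (z, w))) (fa w)" by blast
  then have "ga t \<in> closed_segment (en (z, w)) w"
    by (auto simp: closed_segment_eq_real_ivl incr_homeoD[OF fa(1)] split: if_splits)
  from en_inside[OF assms(1) this] show "pt (fd z - fa w) t \<in> kerE"
    by (simp add: pt_def incr_homeoD[OF fa(1)])
qed (rule assms)

text \<open>Since \<open>D\<close> vanishes at the entry point, it is the integral of
  \<open>F\<close> from there. Integrating the exponential bound in the time \<open>fa w\<close>,
  which moves away from 0, gains the factor \<open>1 / K\<close>.\<close>

lemma sol_bound:
  assumes sol: "char_sol a d D F" and K: "K > 0" and N: "N \<ge> 0"
    and D: "\<And>z w. (z, w) \<in> kerE \<Longrightarrow> en (z, w) = w \<Longrightarrow> D z w = 0"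
    and F: "\<And>z w. (z, w) \<in> kerE \<Longrightarrow> \<bar>F z w\<bar> \<le> N * exp (K * \<bar>fa w\<bar>)"
    and zw: "(z, w) \<in> kerE"
  shows "\<bar>D z w\<bar> \<le> N / K * exp (K * \<bar>fa w\<bar>)"
proof -
  note h = incr_homeoD[OF fa(1)]
  define \<kappa> where "\<kappa> = fd z - fa w"
  define t where "t = fa (en (z, w))"
  have end1: "pt \<kappa> (fa w) = (z, w)"
    by (simp add: pt_def \<kappa>_def gd h)
  have b: "en (z, w) \<in> closed_segment 0 w" by (rule en_between[OF zw])
  have inE: "pt \<kappa> x \<in> kerE" if "x \<in> closed_segment t (fa w)" for x
    using char_curve_from_entry[OF zw, of x x] that by (simp add: char_curve_def t_def \<kappa>_def)
  have "pt \<kappa> t \<in> kerE" by (rule inE) auto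
  then have "D (fst (pt \<kappa> t)) (snd (pt \<kappa> t)) = 0"
  proof -
    have e: "pt \<kappa> t = (gd (fd z - fa w + fa (en (z, w))), en (z, w))"
      by (simp add: pt_def \<kappa>_def t_def h)
    have "0 \<le> en (z, w) * w"
      using b by (auto simp: closed_segment_eq_real_ivl zero_le_mult_iff split: if_splits)
    \<comment> \<open>As \<open>en\<close> is constant along the characteristic, the entry point is
      its own entry point, and the hypothesis on \<open>D\<close> applies to it.\<close>
    then have "en (pt \<kappa> t) = en (z, w)"
      using \<open>pt \<kappa> t \<in> kerE\<close> zw unfolding e by (intro en_inv) (auto simp: gd)
    then show ?thesis
      using \<open>pt \<kappa> t \<in> kerE\<close> D unfolding e by auto
  qed
  note end0 = this
  have Fb: "\<bar>F (fst (pt \<kappa> x)) (snd (pt \<kappa> x))\<bar> \<le> N * exp (K * \<bar>x\<bar>)" if "x \<in> closed_segment t (fa w)" for x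
    using F[of "fst (pt \<kappa> x)" "snd (pt \<kappa> x)"] inE[OF that] by (simp add: pt_def h)
  have int: "\<bar>I\<bar> \<le> J"
    if "(f has_integral I) S" "(g has_integral J) S" "\<And>x. x \<in> S \<Longrightarrow> \<bar>f x\<bar> \<le> g x"
    for f g :: "real \<Rightarrow> real" and I J S
  proof -
    have "I \<le> J"
      by (rule has_integral_le[OF that(1,2)]) (use that(3) in fastforce)
    moreover have "- I \<le> J"
      by (rule has_integral_le[OF has_integral_neg[OF that(1)] that(2)]) (use that(3) in fastforce)
    ultimately show ?thesis by auto
  qed
  show ?thesis
  proof (cases "0 \<le> w")
    case True
    then have tw: "0 \<le> t" "t \<le> fa w" "0 \<le> fa w"
      using b fa(2) h(3)[of 0 w] h(3)[of 0 "en (z, w)"] unfolding t_def by (auto simp: closed_segment_eq_real_ivl h)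
    have "char_curve a d t (fa w) (pt \<kappa>)"
      unfolding \<kappa>_def by (rule char_curve_from_entry[OF zw]) (use tw in \<open>auto simp: closed_segment_eq_real_ivl t_def\<close>)
    with sol have "((\<lambda>s. F (fst (pt \<kappa> s)) (snd (pt \<kappa> s))) has_integral D z w) {t..fa w}"
      unfolding char_sol_def using end0 end1 by fastforce
    moreover have "((\<lambda>s. N * exp (K * s)) has_integral N / K * exp (K * fa w) - N / K * exp (K * t)) {t..fa w}"
      using tw K by (intro fundamental_theorem_of_calculus)
        (auto intro!: derivative_eq_intros simp: has_real_derivative_iff_has_vector_derivative[symmetric])
    ultimately have "\<bar>D z w\<bar> \<le> N / K * exp (K * fa w) - N / K * exp (K * t)"
    proof (rule int)
      fix x assume "x \<in> {t..fa w}"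
      then show "\<bar>F (fst (pt \<kappa> x)) (snd (pt \<kappa> x))\<bar> \<le> N * exp (K * x)"
        using Fb[of x] tw by (auto simp: closed_segment_eq_real_ivl)
    qed
    also have "\<dots> \<le> N / K * exp (K * \<bar>fa w\<bar>)"
      using K N tw by simp
    finally show ?thesis .
  next
    case False
    then have tw: "t \<le> 0" "fa w \<le> t" "fa w \<le> 0"
      using b fa(2) h(3)[of w 0] h(3)[of "en (z, w)" 0] unfolding t_def by (auto simp: closed_segment_eq_real_ivl h)
    \<comment> \<open>For \<open>w < 0\<close> the parameter increases from \<open>(z, w)\<close>
      towards the entry point, so the integral equation yields \<open>- D z w\<close>.\<close>
    have "char_curve a d (fa w) t (pt \<kappa>)"
      unfolding \<kappa>_def by (rule char_curve_from_entry[OF zw]) (use tw in \<open>auto simp: closed_segment_eq_real_ivl t_def\<close>)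
    with sol have "((\<lambda>s. F (fst (pt \<kappa> s)) (snd (pt \<kappa> s))) has_integral - D z w) {fa w..t}"
      unfolding char_sol_def using end0 end1 by fastforce
    moreover have "((\<lambda>s. N * exp (- K * s)) has_integral - N / K * exp (- K * t) - (- N / K * exp (- K * fa w))) {fa w..t}"
      using tw K by (intro fundamental_theorem_of_calculus)
        (auto intro!: derivative_eq_intros simp: has_real_derivative_iff_has_vector_derivative[symmetric])
    ultimately have "\<bar>- D z w\<bar> \<le> - N / K * exp (- K * t) - (- N / K * exp (- K * fa w))"
    proof (rule int)
      fix x assume "x \<in> {fa w..t}"
      then show "\<bar>F (fst (pt \<kappa> x)) (snd (pt \<kappa> x))\<bar> \<le> N * exp (- K * x)"
        using Fb[of x] tw by (auto simp: closed_segment_eq_real_ivl split: if_splits)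
    qed
    also have "\<dots> \<le> N / K * exp (K * \<bar>fa w\<bar>)"
      using K N tw by simp
    finally show ?thesis by simp
  qed
qed

end


subsection \<open>Coupled pairs\<close>

text \<open>Here \<open>P\<close> will be the equation for \<open>L11\<close> or \<open>L22\<close>,
  and \<open>Q\<close> the one for \<open>L12\<close> or \<open>L21\<close>. Both use the same
  \<open>a\<close> and \<open>fa\<close>, so one weight serves the pair.\<close>

locale transport_pair =
  P: transport a dP fa ga fP gP enP + Q: transport a dQ fa ga fQ gQ enQ
  for a dP dQ fa ga fP gP fQ gQ :: "real \<Rightarrow> real" and enP enQ :: "real \<times> real \<Rightarrow> real" +
  fixes p1 p2 q1 q2 :: "real \<Rightarrow> real" and C :: real
  assumes coeff_cont: "continuous_on UNIV p1" "continuous_on UNIV p2" "continuous_on UNIV q1" "continuous_on UNIV q2"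
    and C_pos: "C > 0"
    and coeff_bound: "\<And>x. \<bar>p1 x\<bar> \<le> C" "\<And>x. \<bar>p2 x\<bar> \<le> C" "\<And>x. \<bar>q1 x\<bar> \<le> C" "\<And>x. \<bar>q2 x\<bar> \<le> C"
begin

text \<open>The rate \<open>8 * C\<close> is chosen against the bound \<open>2 * C\<close> for two
  coefficients: integration then gains \<open>2 * C / (8 * C) = 1 / 4\<close> per component, hence a
  contraction factor 1/2 for a pair.\<close>

definition wt :: "real \<Rightarrow> real" where
  "wt w = exp (8 * C * \<bar>fa w\<bar>)"

lemma wt_pos: "wt w > 0"
  by (simp add: wt_def)

lemma continuous_on_wt [continuous_intros]:
  "continuous_on S f \<Longrightarrow> continuous_on S (\<lambda>x. wt (f x))"
  unfolding wt_def
  by (intro continuous_intros continuous_on_compose2[OF incr_homeoD(8)[OF P.fa(1), of UNIV]]) auto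

lemma weighted_bound:
  assumes "transport a d fa ga f g en" "char_sol a d D F" "N \<ge> 0"
    and "\<And>z w. (z, w) \<in> kerE \<Longrightarrow> en (z, w) = w \<Longrightarrow> D z w = 0"
    and "\<And>z w. (z, w) \<in> kerE \<Longrightarrow> \<bar>F z w\<bar> \<le> 2 * C * N * wt w"
    and "(z, w) \<in> kerE"
  shows "\<bar>D z w\<bar> \<le> N / 4 * wt w"
  using transport.sol_bound[OF assms(1,2), of "8 * C" "2 * C * N" z w] assms(3-) C_pos
  by (auto simp: wt_def)

lemma coeff_combination_bound:
  assumes "\<bar>r\<bar> \<le> C" "\<bar>s\<bar> \<le> C" "\<bar>x\<bar> \<le> B" "\<bar>y\<bar> \<le> B"
  shows "\<bar>r * x + s * y\<bar> \<le> 2 * C * B"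
proof -
  have "\<bar>r * x\<bar> \<le> C * B" "\<bar>s * y\<bar> \<le> C * B"
    using assms by (auto simp: abs_mult intro!: mult_mono)
  then show ?thesis by linarith
qed

text \<open>The differences solve the homogeneous system with zero entry data, so each pass through
  the weighted bound divides their bound by 4. A plain bound \<open>B\<close> starts the iteration,
  which covers an \<open>L12\<close> that is merely bounded.\<close>

lemma unique:
  assumes sol: "char_sol a dP L (\<lambda>z w. p1 z * L z w + p2 z * M z w)"
      "char_sol a dQ M (\<lambda>z w. q1 z * L z w + q2 z * M z w)"
      "char_sol a dP L' (\<lambda>z w. p1 z * L' z w + p2 z * M' z w)"
      "char_sol a dQ M' (\<lambda>z w. q1 z * L' z w + q2 z * M' z w)"
    and bdd: "\<And>z w. (z, w) \<in> kerE \<Longrightarrow> \<bar>L z w - L' z w\<bar> \<le> B" "\<And>z w. (z, w) \<in> kerE \<Longrightarrow> \<bar>M z w - M' z w\<bar> \<le> B"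
    and eq: "\<And>z w. (z, w) \<in> kerE \<Longrightarrow> enP (z, w) = w \<Longrightarrow> L z w = L' z w"
      "\<And>z w. (z, w) \<in> kerE \<Longrightarrow> enQ (z, w) = w \<Longrightarrow> M z w = M' z w"
    and zw: "(z, w) \<in> kerE"
  shows "L z w = L' z w" "M z w = M' z w"
proof -
  have B: "B \<ge> 0" using bdd(1)[OF zw] by linarith
  have step: "\<bar>L z w - L' z w\<bar> \<le> B / 4 ^ n * wt w \<and> \<bar>M z w - M' z w\<bar> \<le> B / 4 ^ n * wt w"
    if "(z, w) \<in> kerE" for z w n
    using that
  proof (induction n arbitrary: z w)
    case 0
    have "1 \<le> wt w"
      unfolding wt_def using C_pos by simp
    then have "B \<le> B * wt w"
      using B by (simp add: mult_le_cancel_left1)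
    then show ?case
      using bdd[OF 0] by simp
  next
    case (Suc n)
    have le: "\<bar>r z * (L z w - L' z w) + s z * (M z w - M' z w)\<bar> \<le> 2 * C * (B / 4 ^ n) * wt w"
      if "(z, w) \<in> kerE" "\<bar>r z\<bar> \<le> C" "\<bar>s z\<bar> \<le> C" for r s z w
      using coeff_combination_bound[of "r z" "s z" "L z w - L' z w" "B / 4 ^ n * wt w" "M z w - M' z w"]
        that Suc.IH[OF that(1)] by (simp add: mult.assoc)
    have "\<bar>L z w - L' z w\<bar> \<le> (B / 4 ^ n) / 4 * wt w"
    proof (rule weighted_bound[OF P.transport_axioms char_sol_diff[OF sol(1,3)]])
      show "\<bar>p1 z * L z w + p2 z * M z w - (p1 z * L' z w + p2 z * M' z w)\<bar> \<le> 2 * C * (B / 4 ^ n) * wt w"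
        if "(z, w) \<in> kerE" for z w
        using le[of z w p1 p2] that coeff_bound by (simp add: algebra_simps)
    qed (use B eq Suc.prems in auto)
    moreover have "\<bar>M z w - M' z w\<bar> \<le> (B / 4 ^ n) / 4 * wt w"
    proof (rule weighted_bound[OF Q.transport_axioms char_sol_diff[OF sol(2,4)]])
      show "\<bar>q1 z * L z w + q2 z * M z w - (q1 z * L' z w + q2 z * M' z w)\<bar> \<le> 2 * C * (B / 4 ^ n) * wt w"
        if "(z, w) \<in> kerE" for z w
        using le[of z w q1 q2] that coeff_bound by (simp add: algebra_simps)
    qed (use B eq Suc.prems in auto)
    ultimately show ?case by (simp add: mult.commute)
  qed
  have "(\<lambda>n. B * wt w * (1 / 4) ^ n) \<longlonglongrightarrow> 0"
    by (intro tendsto_mult_right_zero LIMSEQ_power_zero) simp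
  then have "(\<lambda>n. B / 4 ^ n * wt w) \<longlonglongrightarrow> 0"
    by (simp add: power_one_over field_simps)
  then have "\<bar>L z w - L' z w\<bar> \<le> 0" "\<bar>M z w - M' z w\<bar> \<le> 0"
    by (rule LIMSEQ_le_const; use step[OF zw] in blast)+
  then show "L z w = L' z w" "M z w = M' z w" by auto
qed

text \<open>The unknown \<open>u\<close> is the pair of kernels divided by the weight, so the sup
  distance of bounded continuous functions is the weighted distance; the factor \<open>wt\<close>
  restores the kernels.\<close>

definition rhs :: "(real \<Rightarrow> real) \<Rightarrow> (real \<Rightarrow> real) \<Rightarrow> ((real \<times> real) \<Rightarrow>\<^sub>C (real \<times> real)) \<Rightarrow> real \<times> real \<Rightarrow> real" where
  "rhs r s u p = r (fst p) * (wt (snd p) * fst (u p)) + s (fst p) * (wt (snd p) * snd (u p))"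

lemma continuous_on_rhs:
  assumes "continuous_on UNIV r" "continuous_on UNIV s"
  shows "continuous_on UNIV (rhs r s u)"
  unfolding rhs_def[abs_def]
  by (intro continuous_intros continuous_on_compose2[OF assms(1)] continuous_on_compose2[OF assms(2)]) auto

lemma rhs_diff_bound:
  assumes "\<And>x. \<bar>r x\<bar> \<le> C" "\<And>x. \<bar>s x\<bar> \<le> C"
  shows "\<bar>rhs r s u (z, w) - rhs r s v (z, w)\<bar> \<le> 2 * C * dist u v * wt w"
proof -
  have "dist (fst (u p)) (fst (v p)) \<le> dist u v" "dist (snd (u p)) (snd (v p)) \<le> dist u v" for p
    using dist_fst_le[of "u p" "v p"] dist_snd_le[of "u p" "v p"] dist_bounded[of u p v] by linarith+
  then have "\<bar>wt w * (fst (u p) - fst (v p))\<bar> \<le> wt w * dist u v" "\<bar>wt w * (snd (u p) - snd (v p))\<bar> \<le> wt w * dist u v" for p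
    using wt_pos[of w] by (auto simp: dist_real_def abs_mult)
  from coeff_combination_bound[OF assms(1)[of z] assms(2)[of z] this[of "(z, w)"]]
  show ?thesis
    by (simp add: rhs_def algebra_simps)
qed

text \<open>Banach's fixed point theorem in the weighted norm. The functions \<open>\<beta>P\<close>
  and \<open>\<beta>Q\<close> are the boundary data already carried into \<open>kerE\<close> along
  characteristics.\<close>

lemma exists:
  assumes \<beta>: "continuous_on kerE \<beta>P" "continuous_on kerE \<beta>Q" "P.char_invariant \<beta>P" "Q.char_invariant \<beta>Q"
  obtains L M where "continuous_on kerE (\<lambda>(z, w). L z w)" "continuous_on kerE (\<lambda>(z, w). M z w)"
    "char_sol a dP L (\<lambda>z w. p1 z * L z w + p2 z * M z w)"
    "char_sol a dQ M (\<lambda>z w. q1 z * L z w + q2 z * M z w)"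
    "\<And>z w. (z, w) \<in> kerE \<Longrightarrow> enP (z, w) = w \<Longrightarrow> L z w = \<beta>P (z, w)"
    "\<And>z w. (z, w) \<in> kerE \<Longrightarrow> enQ (z, w) = w \<Longrightarrow> M z w = \<beta>Q (z, w)"
proof -
  define SP where "SP u = P.sol \<beta>P (rhs p1 p2 u)" for u
  define SQ where "SQ u = Q.sol \<beta>Q (rhs q1 q2 u)" for u
  define S where "S u p = (SP u (retr p) / wt (snd (retr p)), SQ u (retr p) / wt (snd (retr p)))" for u p
  have contP: "continuous_on kerE (SP u)" and contQ: "continuous_on kerE (SQ u)" for u
    unfolding SP_def SQ_def
    by (intro P.continuous_on_sol Q.continuous_on_sol continuous_on_rhs coeff_cont \<beta>)+
  have S_mem: "S u \<in> bcontfun" for u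
  proof -
    have c: "continuous_on kerE (\<lambda>p. (SP u p / wt (snd p), SQ u p / wt (snd p)))"
      using wt_pos by (intro continuous_intros contP contQ) (auto simp: less_imp_neq[symmetric] order.strict_implies_not_eq)
    have "continuous_on UNIV (S u)"
      unfolding S_def[abs_def]
      by (rule continuous_on_compose2[OF c retr(3)]) (auto simp: retr(1))
    moreover have "range (S u) \<subseteq> (\<lambda>p. (SP u p / wt (snd p), SQ u p / wt (snd p))) ` kerE"
      using retr(1) by (auto simp: S_def)
    then have "bounded (range (S u))"
      using c compact_kerE by (meson bounded_subset compact_continuous_image compact_imp_bounded)
    ultimately show ?thesis
      by (simp add: bcontfun_def)
  qed
  \<comment> \<open>Both images equal the same \<open>\<beta>\<close> at entry points, so their
    difference has zero entry data and the weighted bound applies.\<close>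
  have SPd: "\<bar>SP u (z, w) - SP v (z, w)\<bar> \<le> dist u v / 4 * wt w"
    and SQd: "\<bar>SQ u (z, w) - SQ v (z, w)\<bar> \<le> dist u v / 4 * wt w" if "(z, w) \<in> kerE" for u v z w
  proof -
    show "\<bar>SP u (z, w) - SP v (z, w)\<bar> \<le> dist u v / 4 * wt w"
      unfolding SP_def
      by (rule weighted_bound[OF P.transport_axioms char_sol_diff[OF
           P.char_sol_sol[OF continuous_on_rhs \<beta>(3)] P.char_sol_sol[OF continuous_on_rhs \<beta>(3)]]])
         (auto simp: coeff_cont that P.sol_entry intro: rhs_diff_bound coeff_bound)
    show "\<bar>SQ u (z, w) - SQ v (z, w)\<bar> \<le> dist u v / 4 * wt w"
      unfolding SQ_def
      by (rule weighted_bound[OF Q.transport_axioms char_sol_diff[OF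
           Q.char_sol_sol[OF continuous_on_rhs \<beta>(4)] Q.char_sol_sol[OF continuous_on_rhs \<beta>(4)]]])
         (auto simp: coeff_cont that Q.sol_entry intro: rhs_diff_bound coeff_bound)
  qed
  have "dist (Bcontfun (S u)) (Bcontfun (S v)) \<le> 1 / 2 * dist u v" for u v
  proof (rule dist_bound)
    fix p
    obtain z w where zw: "retr p = (z, w)" "(z, w) \<in> kerE"
      using retr(1)[of p] by (cases "retr p") auto
    have "\<bar>SP u (z, w) / wt w - SP v (z, w) / wt w\<bar> \<le> dist u v / 4"
      "\<bar>SQ u (z, w) / wt w - SQ v (z, w) / wt w\<bar> \<le> dist u v / 4"
      using SPd[OF zw(2), of u v] SQd[OF zw(2), of u v] wt_pos[of w]
      by (auto simp: diff_divide_distrib[symmetric] pos_divide_le_eq)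
    \<comment> \<open>The Euclidean norm of a pair is at most the sum of the absolute values of its
      components.\<close>
    then have "dist (S u p) (S v p) \<le> dist u v / 4 + dist u v / 4"
      unfolding S_def zw(1) dist_Pair_Pair
      by (intro order_trans[OF sqrt_sum_squares_le_sum]) (auto simp: dist_real_def)
    then show "dist (apply_bcontfun (Bcontfun (S u)) p) (apply_bcontfun (Bcontfun (S v)) p) \<le> 1 / 2 * dist u v"
      by (simp add: Bcontfun_inverse S_mem)
  qed
  then obtain u where "Bcontfun (S u) = u"
    using banach_fix_type[of "1/2" "\<lambda>u. Bcontfun (S u)"] by auto
  then have "apply_bcontfun u = S u"
    using Bcontfun_inverse[OF S_mem[of u]] by simp
  then have fp: "wt w * fst (u (z, w)) = SP u (z, w)" "wt w * snd (u (z, w)) = SQ u (z, w)"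
    if "(z, w) \<in> kerE" for z w
    using wt_pos[of w] by (auto simp: S_def retr(2) that)
  have solP: "char_sol a dP (\<lambda>z w. SP u (z, w)) (\<lambda>z w. rhs p1 p2 u (z, w))"
    unfolding SP_def by (intro P.char_sol_sol continuous_on_rhs coeff_cont \<beta>)
  have solQ: "char_sol a dQ (\<lambda>z w. SQ u (z, w)) (\<lambda>z w. rhs q1 q2 u (z, w))"
    unfolding SQ_def by (intro Q.char_sol_sol continuous_on_rhs coeff_cont \<beta>)
  show ?thesis
  proof (rule that[of "\<lambda>z w. SP u (z, w)" "\<lambda>z w. SQ u (z, w)"])
    show "char_sol a dP (\<lambda>z w. SP u (z, w)) (\<lambda>z w. p1 z * SP u (z, w) + p2 z * SQ u (z, w))"
      by (rule char_sol_cong[THEN iffD1, OF _ solP]) (simp add: rhs_def fp)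
    show "char_sol a dQ (\<lambda>z w. SQ u (z, w)) (\<lambda>z w. q1 z * SP u (z, w) + q2 z * SQ u (z, w))"
      by (rule char_sol_cong[THEN iffD1, OF _ solQ]) (simp add: rhs_def fp)
  qed (use contP contQ in \<open>auto simp: SP_def SQ_def P.sol_entry Q.sol_entry split_def\<close>)
qed

end


section \<open>Travel times of a positive speed\<close>

lemma travel_time:
  fixes f :: "real \<Rightarrow> real"
  assumes "continuous_on {-1..1} f" "\<And>x. x \<in> {-1..1} \<Longrightarrow> f x > 0"
  obtains F G \<delta> where "F 0 = 0" "\<And>x. (F has_real_derivative 1 / f (clamp1 x)) (at x)" "incr_homeo F G"
    "\<delta> > 0" "\<And>x. \<delta> \<le> 1 / f (clamp1 x)"
proof -
  obtain M where M: "M > 0" "\<And>x. \<bar>f (clamp1 x)\<bar> \<le> M"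
    using compose_clamp1_bounded[OF assms(1)] by blast
  have pos: "f (clamp1 x) > 0" for x
    using assms(2) by simp
  have "continuous_on UNIV (\<lambda>x. 1 / f (clamp1 x))"
    using pos by (intro continuous_intros continuous_on_compose_clamp1[OF assms(1)]) (metis less_irrefl)
  then obtain F where F: "F 0 = 0" "\<And>x. (F has_real_derivative 1 / f (clamp1 x)) (at x)"
    using antiderivative_UNIV by blast
  \<comment> \<open>An upper bound on the speed bounds the derivative of the travel time from
    below.\<close>
  have \<delta>: "1 / M \<le> 1 / f (clamp1 x)" for x
    using M(2)[of x] pos[of x] by (intro divide_left_mono) (auto simp: M(1))
  moreover obtain G where "incr_homeo F G"
    using incr_homeo_if_deriv_bounded_below[OF F(2) _ \<delta>] M(1) by auto
  ultimately show ?thesis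
    using F M(1) by (intro that[of F G "1 / M"]) auto
qed

subsection \<open>Entry points of the characteristics\<close>

text \<open>Along the characteristic \<open>fa x - fa y\<close> keeps its value \<open>k\<close>; at
  the antidiagonal \<open>y = - x\<close> this reads \<open>fa x - fa (- x) = k\<close>, so the
  entry height is \<open>c k\<close>.\<close>

lemma transport_same_direction:
  assumes fa: "incr_homeo fa ga" "fa 0 = 0" "\<And>x. (fa has_real_derivative 1 / a x) (at x)" "\<And>x. a x > 0"
    and c: "incr_homeo (\<lambda>w. fa w - fa (- w)) c"
  shows "transport a a fa ga fa ga (\<lambda>(z, w). c (fa w - fa z))"
proof
  note h = incr_homeoD[OF fa(1)] and hc = incr_homeoD[OF c]
  show "continuous_on kerE (\<lambda>(z, w). c (fa w - fa z))"
    unfolding split_def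
    by (intro continuous_on_compose2[OF hc(9)[of UNIV]] continuous_intros continuous_on_compose2[OF h(8)[of UNIV]]) auto
  fix z w assume zw: "(z, w) \<in> kerE"
  show between: "(case (z, w) of (z, w) \<Rightarrow> c (fa w - fa z)) \<in> closed_segment 0 w"
    using zw by (auto simp: kerE_iff closed_segment_eq_real_ivl hc h split: if_splits)
  show "(ga (fa z - fa w + fa x), x) \<in> kerE"
    if "x \<in> closed_segment (case (z, w) of (z, w) \<Rightarrow> c (fa w - fa z)) w" for x
  proof -
    define y where "y = ga (fa z - fa w + fa x)"
    have y: "fa y = fa z - fa w + fa x" by (simp add: y_def h)
    \<comment> \<open>The side of the diagonal never changes along the curve, and the side of the
      antidiagonal is decided by comparing \<open>x\<close> with the entry height.\<close>
    have "fa z \<le> fa w \<longleftrightarrow> fa y \<le> fa x" "fa w \<le> fa z \<longleftrightarrow> fa x \<le> fa y"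
      "fa w - fa z \<le> fa x - fa (- x) \<longleftrightarrow> fa (- x) \<le> fa y" "fa w - fa z \<ge> fa x - fa (- x) \<longleftrightarrow> fa (- x) \<ge> fa y"
      using y by auto
    then have "(y, x) \<in> kerE"
      using zw that between by (auto simp: kerE_iff closed_segment_eq_real_ivl hc h split: if_splits)
    then show ?thesis by (simp add: y_def)
  qed
qed (use assms in \<open>auto simp: incr_homeoD[OF fa(1)] less_imp_neq[symmetric] algebra_simps intro!: arg_cong[of _ _ c]\<close>)

text \<open>The case of \<open>L\<^sup>2\<^sup>1\<close>: all characteristics enter through the diagonal.\<close>
lemma transport_opposite_diagonal:
  assumes fa: "incr_homeo fa ga" "fa 0 = 0" "\<And>x. (fa has_real_derivative 1 / a x) (at x)" "\<And>x. a x > 0"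
    and fe: "incr_homeo fe ge" "fe 0 = 0" "\<And>x. (fe has_real_derivative 1 / e x) (at x)" "\<And>x. e x > 0"
    and p: "incr_homeo (\<lambda>w. fa w + fe w) p"
    and mono: "\<And>x y. x \<le> y \<Longrightarrow> fa x + fe (- x) \<le> fa y + fe (- y)"
  shows "transport a (\<lambda>z. - e z) fa ga (\<lambda>z. - fe z) (\<lambda>y. ge (- y)) (\<lambda>(z, w). p (fa w + fe z))"
proof
  note h = incr_homeoD[OF fa(1)] and he = incr_homeoD[OF fe(1)] and hp = incr_homeoD[OF p]
  show "((\<lambda>z. - fe z) has_real_derivative 1 / - e x) (at x)" for x
    using fe(3)[of x] by (auto intro!: derivative_eq_intros)
  show "continuous_on UNIV (\<lambda>y. ge (- y))"
    by (intro continuous_on_compose2[OF he(9)[of UNIV]] continuous_intros) auto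
  show "continuous_on kerE (\<lambda>(z, w). p (fa w + fe z))"
    unfolding split_def
    by (intro continuous_on_compose2[OF hp(9)[of UNIV]] continuous_intros continuous_on_compose2[OF h(8)[of UNIV]]
        continuous_on_compose2[OF he(8)[of UNIV]]) auto
  fix z w assume zw: "(z, w) \<in> kerE"
  show between: "(case (z, w) of (z, w) \<Rightarrow> p (fa w + fe z)) \<in> closed_segment 0 w"
  proof (cases "w \<le> 0")
    case True
    then have "fe w \<le> fe z" "fe z \<le> fe (- w)" using zw by (auto simp: kerE_iff he)
    \<comment> \<open>By \<open>mono\<close>,
      \<open>fa w + fe z \<le> fa w + fe (- w) \<le> 0\<close>, which puts the entry height on the
      correct side of 0.\<close>
    then have "w \<le> p (fa w + fe z)" "p (fa w + fe z) \<le> 0"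
      using mono[OF True] fa(2) fe(2) by (simp_all add: hp)
    then show ?thesis by (simp add: closed_segment_eq_real_ivl)
  next
    case False
    then have "fe z \<le> fe w" "fe (- w) \<le> fe z" using zw by (auto simp: kerE_iff he)
    then have "p (fa w + fe z) \<le> w" "0 \<le> p (fa w + fe z)"
      using mono[of 0 w] False fa(2) fe(2) by (simp_all add: hp)
    then show ?thesis by (simp add: closed_segment_eq_real_ivl)
  qed
  show "(ge (- (- fe z - fa w + fa x)), x) \<in> kerE"
    if "x \<in> closed_segment (case (z, w) of (z, w) \<Rightarrow> p (fa w + fe z)) w" for x
  proof -
    define y where "y = ge (- (- fe z - fa w + fa x))"
    have y: "fe y = fe z + fa w - fa x" by (simp add: y_def he)
    have "(y, x) \<in> kerE"
    proof (cases "w \<le> 0")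
      case True
      then have "w \<le> x" "x \<le> p (fa w + fe z)" "x \<le> 0" "fe z \<le> fe (- w)"
        using that between zw by (auto simp: closed_segment_eq_real_ivl kerE_iff he split: if_splits)
      \<comment> \<open>The first inequality is \<open>x \<le> p k\<close> with
        \<open>k = fa w + fe z\<close>; the second is \<open>mono\<close>, by which the antidiagonal
        is not crossed on the way to the diagonal.\<close>
      moreover from this have "fe x \<le> fe y" "fe y \<le> fe (- x)"
        using mono[of w x] y by (simp_all add: hp)
      ultimately show ?thesis using zw by (auto simp: kerE_iff he)
    next
      case False
      then have "x \<le> w" "p (fa w + fe z) \<le> x" "0 \<le> x" "fe (- w) \<le> fe z"
        using that between zw by (auto simp: closed_segment_eq_real_ivl kerE_iff he split: if_splits)
      moreover from this have "fe y \<le> fe x" "fe (- x) \<le> fe y"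
        using mono[of x w] y by (simp_all add: hp)
      ultimately show ?thesis using zw False by (auto simp: kerE_iff he)
    qed
    then show ?thesis by (simp add: y_def)
  qed
qed (use assms in \<open>auto simp: incr_homeoD[OF fe(1)] less_imp_neq[symmetric] algebra_simps intro!: arg_cong[of _ _ p]\<close>)

text \<open>The two branches meet only where \<open>w = 0\<close>, which within \<open>kerE\<close>
  is the origin; there the argument is 0 and \<open>A 0 = B 0\<close>.\<close>

lemma continuous_on_kerE_cases:
  fixes fa fe A B :: "real \<Rightarrow> real"
  assumes "continuous_on UNIV fa" "continuous_on UNIV fe" "continuous_on UNIV A" "continuous_on UNIV B"
    and "fa 0 = 0" "fe 0 = 0" "A 0 = B 0"
  shows "continuous_on kerE (\<lambda>(z, w). if w \<le> 0 then A (fa w + fe z) else B (fa w + fe z))"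
  unfolding split_def
  by (intro continuous_on_cases_le continuous_intros continuous_on_compose2[OF assms(1)]
      continuous_on_compose2[OF assms(2)] continuous_on_compose2[OF assms(3)] continuous_on_compose2[OF assms(4)])
    (use assms in \<open>auto simp: kerE_iff\<close>)

text \<open>If one of the heights is 0, that point is the origin, the common level is 0 and the
  branches agree. Otherwise both heights have the same sign and select the same branch.\<close>

lemma kerE_cases_invariant:
  fixes fa fe A B :: "real \<Rightarrow> real"
  assumes k: "fa w + fe z = fa w' + fe z'" and "(z, w) \<in> kerE" "(z', w') \<in> kerE" "0 \<le> w * w'"
    and "fa 0 = 0" "fe 0 = 0" "A 0 = B 0"
  shows "(if w \<le> 0 then A (fa w + fe z) else B (fa w + fe z)) =
    (if w' \<le> 0 then A (fa w' + fe z') else B (fa w' + fe z'))"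
proof (cases "w = 0 \<or> w' = 0")
  case True
  then have "w = 0 \<and> z = 0 \<or> w' = 0 \<and> z' = 0"
    using assms(2,3) by (auto simp: kerE_iff)
  then have "fa w + fe z = 0"
    using k assms(5,6) by auto
  then show ?thesis using k assms(7) by simp
next
  case False
  then have "w \<le> 0 \<longleftrightarrow> w' \<le> 0"
    using assms(4) by (auto simp: zero_le_mult_iff)
  then show ?thesis using k by simp
qed

text \<open>The case of \<open>L\<^sup>1\<^sup>2\<close>: characteristics enter through the diagonal at height \<open>p k\<close> or through the antidiagonal at
  height \<open>q (- k)\<close>, where \<open>k = fa w + fe z\<close>. The numbers \<open>p k\<close> and \<open>q (- k)\<close> have opposite signs, and the one with the sign of \<open>w\<close>
  is the entry point.\<close>
lemma transport_opposite_both: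
  assumes fa: "incr_homeo fa ga" "fa 0 = 0" "\<And>x. (fa has_real_derivative 1 / a x) (at x)" "\<And>x. a x > 0"
    and fe: "incr_homeo fe ge" "fe 0 = 0" "\<And>x. (fe has_real_derivative 1 / e x) (at x)" "\<And>x. e x > 0"
    and p: "incr_homeo (\<lambda>w. fa w + fe w) p"
    and q: "incr_homeo (\<lambda>w. - (fa w + fe (- w))) q"
  shows "transport a (\<lambda>z. - e z) fa ga (\<lambda>z. - fe z) (\<lambda>y. ge (- y))
    (\<lambda>(z, w). if w \<le> 0 then min (p (fa w + fe z)) (q (- (fa w + fe z))) else max (p (fa w + fe z)) (q (- (fa w + fe z))))"
  (is "transport _ _ _ _ _ _ ?en")
proof
  note h = incr_homeoD[OF fa(1)] and he = incr_homeoD[OF fe(1)] and hp = incr_homeoD[OF p] and hq = incr_homeoD[OF q]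
  have p0: "p 0 = 0" "q 0 = 0"
    using hp(2)[of 0] hq(2)[of 0] fa(2) fe(2) by auto
  show "((\<lambda>z. - fe z) has_real_derivative 1 / - e x) (at x)" for x
    using fe(3)[of x] by (auto intro!: derivative_eq_intros)
  show "continuous_on UNIV (\<lambda>y. ge (- y))"
    by (intro continuous_on_compose2[OF he(9)[of UNIV]] continuous_intros) auto
  show "continuous_on kerE ?en"
    by (rule continuous_on_kerE_cases)
      (auto simp: p0 fa fe h he intro!: continuous_intros hp continuous_on_compose2[OF hq(9)[of UNIV]])
  fix z w assume zw: "(z, w) \<in> kerE"
  show between: "?en (z, w) \<in> closed_segment 0 w"
    using zw fa(2) fe(2)
    by (auto simp: kerE_iff closed_segment_eq_real_ivl hp hq he min_le_iff_disj le_max_iff_disj split: if_splits)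
  show "(ge (- (- fe z - fa w + fa x)), x) \<in> kerE" if "x \<in> closed_segment (?en (z, w)) w" for x
  proof -
    define y where "y = ge (- (- fe z - fa w + fa x))"
    have y: "fe y = fe z + fa w - fa x" by (simp add: y_def he)
    have "(y, x) \<in> kerE"
    proof (cases "w \<le> 0")
      case True
      then have "w \<le> x" "x \<le> p (fa w + fe z)" "x \<le> q (- (fa w + fe z))" "x \<le> 0"
        using that between by (auto simp: closed_segment_eq_real_ivl split: if_splits)
      \<comment> \<open>With \<open>k = fa w + fe z\<close>, \<open>x \<le> p k\<close> means
        \<open>x \<le> y\<close> and \<open>x \<le> q (- k)\<close> means
        \<open>y \<le> - x\<close>; the minimum enforces both inequalities defining
        \<open>kerE\<close>.\<close>
      moreover from this have "fe x \<le> fe y" "fe y \<le> fe (- x)"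
        using y by (simp_all add: hp hq)
      ultimately show ?thesis using zw by (auto simp: kerE_iff he)
    next
      case False
      then have "x \<le> w" "p (fa w + fe z) \<le> x" "q (- (fa w + fe z)) \<le> x" "0 \<le> x"
        using that between by (auto simp: closed_segment_eq_real_ivl split: if_splits)
      moreover from this have "fe y \<le> fe x" "fe (- x) \<le> fe y"
        using y by (simp_all add: hp hq)
      ultimately show ?thesis using zw False by (auto simp: kerE_iff he)
    qed
    then show ?thesis by (simp add: y_def)
  qed
  fix z' w' assume zw': "(z', w') \<in> kerE" "- fe z - fa w = - fe z' - fa w'" "0 \<le> w * w'"
  then show "?en (z, w) = ?en (z', w')"
    unfolding prod.case
    by (intro kerE_cases_invariant[where A = "\<lambda>k. min (p k) (q (- k))" and B = "\<lambda>k. max (p k) (q (- k))"] zw)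
      (auto simp: p0 fa fe)
qed (use assms in \<open>auto simp: incr_homeoD[OF fe(1)] less_imp_neq[symmetric]\<close>)


section \<open>Assembly of the two coupled systems\<close>

lemma bounded_diff_on_kerE:
  fixes L L' :: "real \<Rightarrow> real \<Rightarrow> real"
  assumes "bounded ((\<lambda>(z, w). L z w) ` kerE)" "bounded ((\<lambda>(z, w). L' z w) ` kerE)"
  obtains B where "\<And>z w. (z, w) \<in> kerE \<Longrightarrow> \<bar>L z w - L' z w\<bar> \<le> B"
proof -
  obtain B B' where "\<forall>x\<in>(\<lambda>(z, w). L z w) ` kerE. norm x \<le> B" "\<forall>x\<in>(\<lambda>(z, w). L' z w) ` kerE. norm x \<le> B'"
    using assms by (auto simp: bounded_iff)
  then have "\<bar>L z w\<bar> \<le> B" "\<bar>L' z w\<bar> \<le> B'" if "(z, w) \<in> kerE" for z w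
    using that by fastforce+
  then have "\<bar>L z w - L' z w\<bar> \<le> B + B'" if "(z, w) \<in> kerE" for z w
    using that abs_triangle_ineq4[of "L z w" "L' z w"] by (meson add_mono order_trans)
  then show ?thesis by (rule that)
qed

theorem theorem3:
  fixes lam lam' mu mu' b c :: "real \<Rightarrow> real"
  assumes lam_deriv: "\<And>x. x \<in> {-1..1} \<Longrightarrow> (lam has_real_derivative lam' x) (at x within {-1..1})"
    and lam'_cont: "continuous_on {-1..1} lam'"
    and mu_deriv: "\<And>x. x \<in> {-1..1} \<Longrightarrow> (mu has_real_derivative mu' x) (at x within {-1..1})"
    and mu'_cont: "continuous_on {-1..1} mu'"
    and lam_pos: "\<And>x. x \<in> {-1..1} \<Longrightarrow> lam x > 0"
    and mu_pos: "\<And>x. x \<in> {-1..1} \<Longrightarrow> mu x > 0"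
    and lam_mu: "\<And>w. w \<in> {-1..1} \<Longrightarrow> lam w > mu (-w)"
    and b_cont: "continuous_on {-1..1} b"
    and c_cont: "continuous_on {-1..1} c"
    and h1_0: "b 0 / (lam 0 + mu 0) = 0"
  shows "(\<exists>L11 L12 L21 L22. kernel_solution lam lam' mu mu' b c L11 L12 L21 L22) \<and>
         (\<forall>L11 L12 L21 L22 M11 M12 M21 M22.
            kernel_solution lam lam' mu mu' b c L11 L12 L21 L22 \<and>
            kernel_solution lam lam' mu mu' b c M11 M12 M21 M22 \<longrightarrow>
            (\<forall>(z,w)\<in>kerE. L11 z w = M11 z w \<and> L12 z w = M12 z w \<and>
                            L21 z w = M21 z w \<and> L22 z w = M22 z w))"
proof -
  have lam_cont: "continuous_on {-1..1} lam" and mu_cont: "continuous_on {-1..1} mu"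
    using lam_deriv mu_deriv by (meson DERIV_continuous_on)+
  define l m where "l x = lam (clamp1 x)" and "m x = mu (clamp1 x)" for x
  have l: "continuous_on UNIV l" "l x > 0" and m: "continuous_on UNIV m" "m x > 0" for x
    unfolding l_def m_def using lam_pos mu_pos lam_cont mu_cont by (auto intro: continuous_on_compose_clamp1)
  obtain fl gl \<delta>l where fl: "fl 0 = 0" "\<And>x. (fl has_real_derivative 1 / l x) (at x)" "incr_homeo fl gl"
    and \<delta>l: "\<delta>l > 0" "\<And>x. \<delta>l \<le> 1 / l x"
    using travel_time[OF lam_cont lam_pos] unfolding l_def by blast
  obtain fm gm \<delta>m where fm: "fm 0 = 0" "\<And>x. (fm has_real_derivative 1 / m x) (at x)" "incr_homeo fm gm"
    and \<delta>m: "\<delta>m > 0" "\<And>x. \<delta>m \<le> 1 / m x"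
    using travel_time[OF mu_cont mu_pos] unfolding m_def by blast
  note hl = incr_homeoD[OF fl(3)] and hm = incr_homeoD[OF fm(3)]
  have neg: "((\<lambda>x. f (- x)) has_real_derivative - D) (at x)"
    if "(f has_real_derivative D) (at (- x))" for f x and D :: real
    using DERIV_chain2[OF that DERIV_minus[OF DERIV_ident]] by simp

  \<comment> \<open>The inverses constructed next recover a boundary height from the level of a
    characteristic: \<open>cl\<close> and \<open>cm\<close> at the antidiagonal for
    \<open>L11\<close> and \<open>L22\<close>, \<open>p\<close> at the diagonal for
    \<open>L12\<close> and \<open>L21\<close>, and \<open>q\<close> at the antidiagonal for
    \<open>L12\<close>.\<close>
  have "((\<lambda>w. fl w - fl (- w)) has_real_derivative 1 / l w + 1 / l (- w)) (at w)" for w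
    using DERIV_diff[OF fl(2) neg[OF fl(2)]] by simp
  then obtain cl where cl: "incr_homeo (\<lambda>w. fl w - fl (- w)) cl"
    by (rule incr_homeo_if_deriv_bounded_below) (rule add_pos_pos[OF \<delta>l(1) \<delta>l(1)], rule add_mono[OF \<delta>l(2) \<delta>l(2)])
  have "((\<lambda>w. fm w - fm (- w)) has_real_derivative 1 / m w + 1 / m (- w)) (at w)" for w
    using DERIV_diff[OF fm(2) neg[OF fm(2)]] by simp
  then obtain cm where cm: "incr_homeo (\<lambda>w. fm w - fm (- w)) cm"
    by (rule incr_homeo_if_deriv_bounded_below) (rule add_pos_pos[OF \<delta>m(1) \<delta>m(1)], rule add_mono[OF \<delta>m(2) \<delta>m(2)])
  have "((\<lambda>w. fl w + fm w) has_real_derivative 1 / l w + 1 / m w) (at w)" for w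
    using DERIV_add[OF fl(2) fm(2)] .
  then obtain p where p: "incr_homeo (\<lambda>w. fl w + fm w) p"
    by (rule incr_homeo_if_deriv_bounded_below) (rule add_pos_pos[OF \<delta>l(1) \<delta>m(1)], rule add_mono[OF \<delta>l(2) \<delta>m(2)])
  then have p': "incr_homeo (\<lambda>w. fm w + fl w) p"
    by (simp add: add.commute)
  \<comment> \<open>The assumption \<open>lam w > mu (- w)\<close> enters here: by compactness it
    becomes a uniform lower bound on the derivative of the function inverted by
    \<open>q\<close>.\<close>
  have "continuous_on {-1..1} (\<lambda>x. 1 / mu (- x) - 1 / lam x)"
    using lam_pos mu_pos
    by (intro continuous_intros lam_cont continuous_on_compose2[OF mu_cont]) (auto simp: less_imp_neq[symmetric])
  moreover have "1 / mu (- x) - 1 / lam x > 0" if "x \<in> {-1..1}" for x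
    using lam_mu[OF that] mu_pos[of "-x"] that by (simp add: frac_less2)
  ultimately obtain \<delta> where \<delta>: "\<delta> > 0" "\<And>x. \<delta> \<le> 1 / mu (- clamp1 x) - 1 / lam (clamp1 x)"
    using compose_clamp1_bounded_below[of "\<lambda>x. 1 / mu (- x) - 1 / lam x"] by blast
  have "((\<lambda>w. - (fl w + fm (- w))) has_real_derivative 1 / m (- w) - 1 / l w) (at w)" for w
    using DERIV_minus[OF DERIV_add[OF fl(2) neg[OF fm(2)]]] by simp
  then obtain q where q: "incr_homeo (\<lambda>w. - (fl w + fm (- w))) q"
    by (rule incr_homeo_if_deriv_bounded_below[of _ _ \<delta>]) (use \<delta> in \<open>auto simp: l_def m_def clamp1_uminus\<close>)
  note hcl = incr_homeoD[OF cl] and hcm = incr_homeoD[OF cm] and hp = incr_homeoD[OF p] and hq = incr_homeoD[OF q]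

  have T1: "transport l l fl gl fl gl (\<lambda>(z, w). cl (fl w - fl z))"
    using fl l cl by (intro transport_same_direction)
  define en where "en = (\<lambda>(z, w). if w \<le> 0 then min (p (fl w + fm z)) (q (- (fl w + fm z)))
     else max (p (fl w + fm z)) (q (- (fl w + fm z))))"
  have T2: "transport l (\<lambda>z. - m z) fl gl (\<lambda>z. - fm z) (\<lambda>y. gm (- y)) en"
    unfolding en_def using fl l fm m p q by (intro transport_opposite_both)
  have T3: "transport m m fm gm fm gm (\<lambda>(z, w). cm (fm w - fm z))"
    using fm m cm by (intro transport_same_direction)
  have T4: "transport m (\<lambda>z. - l z) fm gm (\<lambda>z. - fl z) (\<lambda>y. gl (- y)) (\<lambda>(z, w). p (fm w + fl z))"
  proof (rule transport_opposite_diagonal[OF fm(3,1,2) m(2) fl(3,1,2) l(2) p'])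
    \<comment> \<open>This is the monotonicity behind \<open>q\<close> at reflected points, so the
      same speed condition makes all characteristics of \<open>L21\<close> enter through the
      diagonal.\<close>
    show "fm x + fl (- x) \<le> fm y + fl (- y)" if "x \<le> y" for x y
      using hq(3)[of "- y" "- x"] that by simp
  qed

  obtain Cl Cm Cb Cc where C: "Cl > 0" "\<And>x. \<bar>lam' (clamp1 x)\<bar> \<le> Cl" "Cm > 0" "\<And>x. \<bar>mu' (clamp1 x)\<bar> \<le> Cm"
    "Cb > 0" "\<And>x. \<bar>b (clamp1 x)\<bar> \<le> Cb" "Cc > 0" "\<And>x. \<bar>c (clamp1 x)\<bar> \<le> Cc"
    using compose_clamp1_bounded[OF lam'_cont] compose_clamp1_bounded[OF mu'_cont]
      compose_clamp1_bounded[OF b_cont] compose_clamp1_bounded[OF c_cont] by metis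
  define C where "C = Cl + Cm + Cb + Cc"
  have C': "C > 0" "\<bar>lam' (clamp1 x)\<bar> \<le> C" "\<bar>mu' (clamp1 x)\<bar> \<le> C" "\<bar>b (clamp1 x)\<bar> \<le> C" "\<bar>c (clamp1 x)\<bar> \<le> C" for x
    using C(2)[of x] C(4)[of x] C(6)[of x] C(8)[of x] C(1,3,5,7) by (auto simp: C_def)
  note coeff_cont = lam'_cont[THEN continuous_on_compose_clamp1] mu'_cont[THEN continuous_on_compose_clamp1]
    b_cont[THEN continuous_on_compose_clamp1] c_cont[THEN continuous_on_compose_clamp1]
  \<comment> \<open>\<open>S1\<close> couples \<open>L11\<close> with \<open>L12\<close> in the time
    \<open>fl w\<close>, and \<open>S2\<close> couples \<open>L22\<close> with \<open>L21\<close> in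
    the time \<open>fm w\<close>.\<close>
  interpret S1: transport_pair l l "\<lambda>z. - m z" fl gl fl gl "\<lambda>z. - fm z" "\<lambda>y. gm (- y)"
    "\<lambda>(z, w). cl (fl w - fl z)" en
    "\<lambda>z. - lam' (clamp1 z)" "\<lambda>z. - c (clamp1 z)" "\<lambda>z. - b (clamp1 z)" "\<lambda>z. mu' (clamp1 z)" C
    by (intro transport_pair.intro T1 T2 transport_pair_axioms.intro)
      (auto simp: C' intro!: continuous_intros coeff_cont)
  interpret S2: transport_pair m m "\<lambda>z. - l z" fm gm fm gm "\<lambda>z. - fl z" "\<lambda>y. gl (- y)"
    "\<lambda>(z, w). cm (fm w - fm z)" "\<lambda>(z, w). p (fm w + fl z)"
    "\<lambda>z. - mu' (clamp1 z)" "\<lambda>z. b (clamp1 z)" "\<lambda>z. c (clamp1 z)" "\<lambda>z. lam' (clamp1 z)" C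
    by (intro transport_pair.intro T3 T4 transport_pair_axioms.intro)
      (auto simp: C' intro!: continuous_intros coeff_cont)

  have clE: "clamp1 z = z \<and> clamp1 w = w" if "(z, w) \<in> kerE" for z w
    using that by (auto simp: kerE_def intro!: clamp1_id)
  have eq11: "char_sol lam lam L11 (\<lambda>z w. - lam' z * L11 z w - c z * L12 z w) \<longleftrightarrow>
      char_sol l l L11 (\<lambda>z w. - lam' (clamp1 z) * L11 z w + - c (clamp1 z) * L12 z w)" for L11 L12
    by (rule char_sol_cong) (auto simp: l_def dest!: clE)
  have eq12: "char_sol lam (\<lambda>z. - mu z) L12 (\<lambda>z w. - b z * L11 z w + mu' z * L12 z w) \<longleftrightarrow>
      char_sol l (\<lambda>z. - m z) L12 (\<lambda>z w. - b (clamp1 z) * L11 z w + mu' (clamp1 z) * L12 z w)" for L11 L12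
    by (rule char_sol_cong) (auto simp: l_def m_def dest!: clE)
  have eq22: "char_sol mu mu L22 (\<lambda>z w. b z * L21 z w - mu' z * L22 z w) \<longleftrightarrow>
      char_sol m m L22 (\<lambda>z w. - mu' (clamp1 z) * L22 z w + b (clamp1 z) * L21 z w)" for L21 L22
    by (rule char_sol_cong) (auto simp: m_def dest!: clE)
  have eq21: "char_sol mu (\<lambda>z. - lam z) L21 (\<lambda>z w. lam' z * L21 z w + c z * L22 z w) \<longleftrightarrow>
      char_sol m (\<lambda>z. - l z) L21 (\<lambda>z w. c (clamp1 z) * L22 z w + lam' (clamp1 z) * L21 z w)" for L21 L22
    by (rule char_sol_cong) (auto simp: l_def m_def dest!: clE)
  have diag: "(w, w) \<in> kerE \<and> (- w, w) \<in> kerE" if "w \<in> {-1..1}" for w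
    using that by (auto simp: kerE_def)

  define h1 h2 where "h1 x = b (clamp1 x) / (l x + m x)" and "h2 x = - c (clamp1 x) / (l x + m x)" for x
  have lm: "l x + m x \<noteq> 0" for x
    using add_pos_pos[OF l(2) m(2), of x x] by simp
  have h: "continuous_on UNIV h1" "continuous_on UNIV h2"
    unfolding h1_def[abs_def] h2_def[abs_def]
    using lm by (auto intro!: continuous_intros coeff_cont l m)
  have h10: "h1 0 = 0"
    using h1_0 by (simp add: h1_def l_def m_def clamp1_def)
  \<comment> \<open>If \<open>p k\<close> has the sign of \<open>w\<close>, the characteristic
    enters through the diagonal and carries \<open>h1 (p k)\<close>. Otherwise clipping at 0 gives
    \<open>h1 0\<close>, the zero antidiagonal datum, and keeps \<open>\<beta>\<close> continuous
    across the level \<open>k = 0\<close>.\<close>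
  define \<beta> where "\<beta> = (\<lambda>(z, w). if w \<le> 0 then h1 (min (p (fl w + fm z)) 0) else h1 (max (p (fl w + fm z)) 0))"
  have p0: "p 0 = 0"
    using hp(2)[of 0] fl(1) fm(1) by simp
  have \<beta>: "continuous_on kerE \<beta>" "S1.Q.char_invariant \<beta>"
  proof -
    show "continuous_on kerE \<beta>"
      unfolding \<beta>_def
      by (rule continuous_on_kerE_cases[where A = "\<lambda>k. h1 (min (p k) 0)" and B = "\<lambda>k. h1 (max (p k) 0)"])
        (auto simp: p0 fl fm intro!: continuous_on_compose2[OF h(1)] continuous_intros hp hl hm)
    show "S1.Q.char_invariant \<beta>"
      unfolding S1.Q.char_invariant_def \<beta>_def prod.case
      by (intro allI impI
          kerE_cases_invariant[where A = "\<lambda>k. h1 (min (p k) 0)" and B = "\<lambda>k. h1 (max (p k) 0)"])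
        (auto simp: p0 fl fm)
  qed
  have \<beta>2: "continuous_on kerE (\<lambda>(z, w). h2 (p (fm w + fl z)))"
    "S2.Q.char_invariant (\<lambda>(z, w). h2 (p (fm w + fl z)))"
    unfolding S2.Q.char_invariant_def split_def
    by (auto simp: algebra_simps intro!: continuous_on_compose2[OF h(2)] continuous_on_compose2[OF hp(9)[of UNIV]]
        continuous_on_compose2[OF hl(8)[of UNIV]] continuous_on_compose2[OF hm(8)[of UNIV]] continuous_intros
        arg_cong[of _ _ h2] arg_cong[of _ _ p])
  have inv0: "S1.P.char_invariant (\<lambda>_. 0)" "S2.P.char_invariant (\<lambda>_. 0)"
    by (simp_all add: S1.P.char_invariant_def S2.P.char_invariant_def)
  obtain L11 L12 where L1: "continuous_on kerE (\<lambda>(z, w). L11 z w)" "continuous_on kerE (\<lambda>(z, w). L12 z w)"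
    "char_sol l l L11 (\<lambda>z w. - lam' (clamp1 z) * L11 z w + - c (clamp1 z) * L12 z w)"
    "char_sol l (\<lambda>z. - m z) L12 (\<lambda>z w. - b (clamp1 z) * L11 z w + mu' (clamp1 z) * L12 z w)"
    "\<And>z w. (z, w) \<in> kerE \<Longrightarrow> cl (fl w - fl z) = w \<Longrightarrow> L11 z w = 0"
    "\<And>z w. (z, w) \<in> kerE \<Longrightarrow> en (z, w) = w \<Longrightarrow> L12 z w = \<beta> (z, w)"
    apply (rule S1.exists[OF continuous_on_const \<beta>(1) inv0(1) \<beta>(2), unfolded prod.case])
    subgoal premises prems by (rule prems(1)[OF prems(2-)])
    done
  obtain L22 L21 where L2: "continuous_on kerE (\<lambda>(z, w). L22 z w)" "continuous_on kerE (\<lambda>(z, w). L21 z w)"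
    "char_sol m m L22 (\<lambda>z w. - mu' (clamp1 z) * L22 z w + b (clamp1 z) * L21 z w)"
    "char_sol m (\<lambda>z. - l z) L21 (\<lambda>z w. c (clamp1 z) * L22 z w + lam' (clamp1 z) * L21 z w)"
    "\<And>z w. (z, w) \<in> kerE \<Longrightarrow> cm (fm w - fm z) = w \<Longrightarrow> L22 z w = 0"
    "\<And>z w. (z, w) \<in> kerE \<Longrightarrow> p (fm w + fl z) = w \<Longrightarrow> L21 z w = h2 (p (fm w + fl z))"
    apply (rule S2.exists[OF continuous_on_const \<beta>2(1) inv0(2) \<beta>2(2), unfolded prod.case])
    subgoal premises prems by (rule prems(1)[OF prems(2-)])
    done

  have "kernel_solution lam lam' mu mu' b c L11 L12 L21 L22"
    unfolding kernel_solution_def eq11 eq12 eq22 eq21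
  proof (intro conjI ballI L1(1-4) L2(1-4))
    show "bounded ((\<lambda>(z, w). L12 z w) ` kerE)"
      using L1(2) compact_kerE by (meson compact_continuous_image compact_imp_bounded)
    show "set_borel_measurable lebesgue kerE (\<lambda>(z, w). L12 z w)"
    proof -
      have "(\<lambda>x. indicator kerE x *\<^sub>R (case x of (z, w) \<Rightarrow> L12 z w)) \<in> borel_measurable borel"
        by (intro borel_measurable_continuous_on_indicator L1(2) borel_closed compact_imp_closed compact_kerE)
      then show ?thesis
        unfolding set_borel_measurable_def by (intro measurable_completion) simp
    qed
    fix w :: real assume w: "w \<in> {-1..1}"
    note E = diag[OF w, THEN conjunct1] diag[OF w, THEN conjunct2]
    have cw: "clamp1 w = w" using w by (rule clamp1_id)
    show "L11 (- w) w = 0"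
      by (rule L1(5)[OF E(2)]) (rule hcl)
    show "L22 (- w) w = 0"
      by (rule L2(5)[OF E(2)]) (rule hcm)
    have pw: "p (fl w + fm w) = w" by (rule hp)
    have qw: "q (- (fl w + fm (- w))) = w" by (rule hq)
    have "L21 w w = h2 w"
      using L2(6)[OF E(1)] pw by (simp add: add.commute)
    then show "L21 w w = - c w / (lam w + mu w)"
      by (simp add: h2_def l_def m_def cw)
    \<comment> \<open>On the diagonal the candidate \<open>p k\<close> equals \<open>w\<close>; the
      other candidate lies no nearer to 0 than allowed by \<open>min\<close> or \<open>max\<close>,
      so \<open>p k\<close> is selected. The antidiagonal is treated likewise with
      \<open>q\<close>.\<close>
    have "en (w, w) = w"
    proof (cases "w \<le> 0")
      case True
      then have "w \<le> q (- (fl w + fm w))"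
        unfolding hq(7) by (simp add: hm)
      then show ?thesis using True pw by (simp add: en_def)
    next
      case False
      then have "q (- (fl w + fm w)) \<le> w"
        unfolding hq(6) by (simp add: hm)
      then show ?thesis using False pw by (simp add: en_def)
    qed
    then have "L12 w w = \<beta> (w, w)"
      by (rule L1(6)[OF E(1)])
    also have "\<dots> = h1 w"
      using pw by (simp add: \<beta>_def)
    finally show "L12 w w = b w / (lam w + mu w)"
      by (simp add: h1_def l_def m_def cw)
    have "en (- w, w) = w"
    proof (cases "w \<le> 0")
      case True
      then have "w \<le> p (fl w + fm (- w))"
        unfolding hp(7) by (simp add: hm)
      then show ?thesis using True qw by (simp add: en_def)
    next
      case False
      then have "p (fl w + fm (- w)) \<le> w"
        unfolding hp(6) by (simp add: hm)
      then show ?thesis using False qw by (simp add: en_def)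
    qed
    then have "L12 (- w) w = \<beta> (- w, w)"
      by (rule L1(6)[OF E(2)])
    \<comment> \<open>On the antidiagonal \<open>p k\<close> is 0 or has the sign opposite to
      \<open>w\<close>, so the clipping returns 0; then \<open>h1 0 = 0\<close> gives the boundary
      condition.\<close>
    also have "\<dots> = h1 0"
      using hq(3)[of w 0] hq(3)[of 0 w] fl(1) fm(1) by (auto simp: \<beta>_def p0 hp min_def max_def)
    finally show "L12 (- w) w = 0"
      by (simp add: h10)
  qed
  moreover have "L11 z w = M11 z w \<and> L12 z w = M12 z w \<and> L21 z w = M21 z w \<and> L22 z w = M22 z w"
    if L: "kernel_solution lam lam' mu mu' b c L11 L12 L21 L22"
      and M: "kernel_solution lam lam' mu mu' b c M11 M12 M21 M22" and zw: "(z, w) \<in> kerE"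
    for L11 L12 L21 L22 M11 M12 M21 M22 z w
  proof -
    note L = L[unfolded kernel_solution_def eq11 eq12 eq22 eq21]
      and M = M[unfolded kernel_solution_def eq11 eq12 eq22 eq21]
    have bd: "bounded ((\<lambda>(z, w). N z w) ` kerE)" if "continuous_on kerE (\<lambda>(z, w). N z w)" for N :: "real \<Rightarrow> real \<Rightarrow> real"
      using that compact_kerE by (meson compact_continuous_image compact_imp_bounded)
    obtain B11 where B11: "\<And>z w. (z, w) \<in> kerE \<Longrightarrow> \<bar>L11 z w - M11 z w\<bar> \<le> B11"
      using bounded_diff_on_kerE[of L11 M11] L M bd by metis
    obtain B12 where B12: "\<And>z w. (z, w) \<in> kerE \<Longrightarrow> \<bar>L12 z w - M12 z w\<bar> \<le> B12"
      using bounded_diff_on_kerE[of L12 M12] L M by metis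
    obtain B21 where B21: "\<And>z w. (z, w) \<in> kerE \<Longrightarrow> \<bar>L21 z w - M21 z w\<bar> \<le> B21"
      using bounded_diff_on_kerE[of L21 M21] L M bd by metis
    obtain B22 where B22: "\<And>z w. (z, w) \<in> kerE \<Longrightarrow> \<bar>L22 z w - M22 z w\<bar> \<le> B22"
      using bounded_diff_on_kerE[of L22 M22] L M bd by metis
    have w_in: "w \<in> {-1..1}" if "(z, w) \<in> kerE" for z w
      using that by (simp add: kerE_def)
    \<comment> \<open>A point that is its own entry point lies where data are prescribed, so two
      solutions agree there. This is shown for each of the four kernels; for \<open>L12\<close>
      either diagonal may occur.\<close>
    have e11: "L11 z w = M11 z w" if "(z, w) \<in> kerE" "cl (fl w - fl z) = w" for z w
    proof -
      have "z = - w"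
        using hcl(1)[of "fl w - fl z"] that(2) by (simp add: hl)
      then show ?thesis using L M w_in[OF that(1)] by simp
    qed
    have e22: "L22 z w = M22 z w" if "(z, w) \<in> kerE" "cm (fm w - fm z) = w" for z w
    proof -
      have "z = - w"
        using hcm(1)[of "fm w - fm z"] that(2) by (simp add: hm)
      then show ?thesis using L M w_in[OF that(1)] by simp
    qed
    have e21: "L21 z w = M21 z w" if "(z, w) \<in> kerE" "p (fm w + fl z) = w" for z w
    proof -
      have "z = w"
        using hp(1)[of "fm w + fl z"] that(2) by (simp add: hl)
      then show ?thesis using L M w_in[OF that(1)] by simp
    qed
    have e12: "L12 z w = M12 z w" if "(z, w) \<in> kerE" "en (z, w) = w" for z w
    proof -
      have "p (fl w + fm z) = w \<or> q (- (fl w + fm z)) = w"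
        using that(2) by (auto simp: en_def min_def max_def split: if_splits)
      then have "z = w \<or> z = - w"
        using hp(1)[of "fl w + fm z"] hq(1)[of "- (fl w + fm z)"] by (auto simp: hm)
      then show ?thesis using L M w_in[OF that(1)] by auto
    qed
    have "L11 z w = M11 z w \<and> L12 z w = M12 z w"
      using S1.unique[of L11 L12 M11 M12 "max B11 B12" z w] L M B11 B12 e11 e12 zw
      by (simp add: le_max_iff_disj)
    moreover have "L22 z w = M22 z w \<and> L21 z w = M21 z w"
      using S2.unique[of L22 L21 M22 M21 "max B22 B21" z w] L M B22 B21 e22 e21 zw
      by (simp add: le_max_iff_disj)
    ultimately show ?thesis by simp
  qed
  ultimately show ?thesis by blast
qed

end
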